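(* Let $c\ge 1$ be an integer, let $\mu,\nu\in\mathbb{R}$, and let $\mathscr{D}=\mathscr{D}^c_{\mu,\nu}$ be the smooth quantum Heisenberg manifold. Let $U_1,U_2\in\mathscr{D}$ be the unitaries $U_1(p,x,y)=\delta_{0,p}e^{2\pi i x}$ and $U_2(p,x,y)=\delta_{0,p}e^{2\pi i y}$. Among the Chern–Connes pairings $\langle[U_k],[\phi]\rangle$ with $k\in\{1,2\}$ and $\phi\in\{\varphi_1,\varphi_2,\varphi_3,\varphi_{1,2,3}\}$, all vanish except $$\langle[U_1],[\varphi_1]\rangle=-\sqrt{i2\pi},\qquad \langle[U_2],[\varphi_2]\rangle=-\sqrt{i2\pi}.$$
   Context: Notation: $e(x)=e^{2\pi i x}$; square roots are principal. Fix an integer $c\ge 1$ and $\mu,\nu\in\mathbb{R}$. The quantum Heisenberg manifold $D=D^c_{\mu,\nu}$ is the universal C*-completion of the $*$-algebra $D_0$ of functions $F(p,x,y)$, $p\in\mathbb{Z}$, $(x,y)\in\mathbb{R}\times S^1$ ($S^1=\mathbb{R}/\mathbb{Z}$), with finite support in $p$, continuous and bounded in $(x,y)$, satisfying $F(p,x+1,y)=e(-cp(y-p\nu))F(p,x,y)$, with product $(F_1F_2)(p,x,y)=\sum_{q\in\mathbb{Z}}F_1(q,x,y)F_2(p-q,x-2q\mu,y-2q\nu)$ and involution $F^*(p,x,y)=\overline{F(-p,x-2p\mu,y-2p\nu)}$. The Heisenberg group $H_1$ is $\mathbb{R}^3$ with product $(r',s',t')(r,s,t)=(r'+r,s'+s,t'+t+cs'r)$.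 It acts on $D$ by automorphisms $\alpha_{(r,s,t)}(F)(p,x,y)=e\big(-p(t+cs(x-r-p\mu))\big)F(p,x-r,y-s)$. The smooth quantum Heisenberg manifold is $\mathscr{D}=\{F\in D: g\mapsto\alpha_g(F)\text{ is } C^\infty\}$. The derivations $\partial_1,\partial_2,\partial_3$ of $\mathscr{D}$ are the infinitesimal generators of $\alpha$ in the directions $r,s,t$; on smooth elements of $D_0$: $\partial_1F=-\partial F/\partial x$, $\partial_2F=-\partial F/\partial y-2\pi i\,pc(x-p\mu)F$, $\partial_3F=-2\pi i\,pF$. The trace on $D$ is $\tau(F)=\int_0^1\int_{S^1}F(0,x,y)\,dy\,dx$. Cyclic cocycles on $\mathscr{D}$: $\varphi_i(a_0,a_1)=\tau(a_0\partial_i(a_1))$, $i=1,2,3$, and $\varphi_{1,2,3}(a_0,a_1,a_2,a_3)=\sum_{\sigma\in\Sigma_3}\varepsilon(\sigma)\tau(a_0\partial_{\sigma(1)}(a_1)\partial_{\sigma(2)}(a_2)\partial_{\sigma(3)}(a_3))$. Odd Chern–Connes pairing: for a unitary $U$ over $\mathscr{D}$ and a cyclic cocycle $\phi$ of odd degree $n$, $\langle[U],[\phi]\rangle=\frac{2^{-n}}{\sqrt{2i}}\,\Gamma(\tfrac n2+1)^{-1}(\phi\#\mathrm{Tr})(U^*-1,U-1,U^*-1,\dots,U-1)$ with $n+1$ arguments, where $(\phi\#\mathrm{Tr})(a^0\otimes b^0,\dots,a^n\otimes b^n)=\phi(a^0,\dots,a^n)\mathrm{Tr}(b^0\cdots b^n)$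 for $a^j\in\mathscr{D}$, $b^j\in M_k(\mathbb{C})$. *)

theory Defs
  imports "HOL-Analysis.Analysis"
begin

type_synonym hfun = "int \<Rightarrow> real \<Rightarrow> real \<Rightarrow> complex"

text \<open>A point of the completion is an equivalence class of Cauchy sequences in \<open>D\<^sub>0\<close>.\<close>
type_synonym qpt = "(nat \<Rightarrow> hfun) set"

definition ee :: "real \<Rightarrow> complex" where
  "ee x = exp (2 * complex_of_real pi * \<i> * complex_of_real x)"

definition supp :: "hfun \<Rightarrow> int set" where
  "supp F = {p. \<exists>x y. F p x y \<noteq> 0}"

definition add0 :: "hfun \<Rightarrow> hfun \<Rightarrow> hfun" where
  "add0 F G = (\<lambda>p x y. F p x y + G p x y)"

definition diff0 :: "hfun \<Rightarrow> hfun \<Rightarrow> hfun" where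
  "diff0 F G = (\<lambda>p x y. F p x y - G p x y)"

definition scale0 :: "complex \<Rightarrow> hfun \<Rightarrow> hfun" where
  "scale0 z F = (\<lambda>p x y. z * F p x y)"

definition zero0 :: hfun where
  "zero0 = (\<lambda>p x y. 0)"

definition unit0 :: hfun where
  "unit0 = (\<lambda>p x y. if p = 0 then 1 else 0)"

definition U1 :: hfun where
  "U1 = (\<lambda>p x y. if p = 0 then ee x else 0)"

definition U2 :: hfun where
  "U2 = (\<lambda>p x y. if p = 0 then ee y else 0)"

definition tau0 :: "hfun \<Rightarrow> complex" where
  "tau0 F = integral {0..1} (\<lambda>x. integral {0..1} (\<lambda>y. F 0 x y))"

locale quantum_heisenberg =
  fixes c :: int and mu nu :: real
begin

subsection \<open>The *-algebra of functions\<close>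

text \<open>Functions on the circle \<open>\<real>/\<int>\<close> are 1-periodic functions of the real variable \<open>y\<close>.\<close>

definition D0 :: "hfun set" where
  "D0 = {F. finite (supp F) \<and>
     (\<forall>p. continuous_on UNIV (\<lambda>(x, y). F p x y) \<and> bounded (range (\<lambda>(x, y). F p x y))) \<and>
     (\<forall>p x y. F p x (y + 1) = F p x y) \<and>
     (\<forall>p x y. F p (x + 1) y =
        ee (- (of_int c * of_int p * (y - of_int p * nu))) * F p x y)}"

definition mult0 :: "hfun \<Rightarrow> hfun \<Rightarrow> hfun" where
  "mult0 F G = (\<lambda>p x y. \<Sum>q\<in>supp F.
     F q x y * G (p - q) (x - 2 * of_int q * mu) (y - 2 * of_int q * nu))"

definition star0 :: "hfun \<Rightarrow> hfun" where
  "star0 F = (\<lambda>p x y. cnj (F (- p) (x - 2 * of_int p * mu) (y - 2 * of_int p * nu)))"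

text \<open>The vector \<open>g\<close> has the Heisenberg group coordinates \<open>(r, s, t)\<close>.\<close>

definition alpha0 :: "real ^ 3 \<Rightarrow> hfun \<Rightarrow> hfun" where
  "alpha0 g F = (\<lambda>p x y. let r = g $ 1; s = g $ 2; t = g $ 3 in
     ee (- (of_int p * (t + of_int c * s * (x - r - of_int p * mu)))) * F p (x - r) (y - s))"

subsection \<open>The universal C*-completion\<close>

definition cstar_seminorm :: "(hfun \<Rightarrow> real) \<Rightarrow> bool" where
  "cstar_seminorm N \<longleftrightarrow>
     (\<forall>F\<in>D0. 0 \<le> N F) \<and>
     (\<forall>F\<in>D0. \<forall>G\<in>D0. N (add0 F G) \<le> N F + N G) \<and>
     (\<forall>F\<in>D0. \<forall>z. N (scale0 z F) = cmod z * N F) \<and>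
     (\<forall>F\<in>D0. \<forall>G\<in>D0. N (mult0 F G) \<le> N F * N G) \<and>
     (\<forall>F\<in>D0. N (mult0 (star0 F) F) = (N F)\<^sup>2)"

definition unorm :: "hfun \<Rightarrow> real" where
  "unorm F = Sup {N F | N. cstar_seminorm N}"

definition cauchy_seqs :: "(nat \<Rightarrow> hfun) set" where
  "cauchy_seqs = {F. (\<forall>n. F n \<in> D0) \<and>
     (\<forall>\<epsilon>>0. \<exists>M. \<forall>m\<ge>M. \<forall>n\<ge>M. unorm (diff0 (F m) (F n)) < \<epsilon>)}"

definition cauchy_rel :: "((nat \<Rightarrow> hfun) \<times> (nat \<Rightarrow> hfun)) set" where
  "cauchy_rel = {(F, G). F \<in> cauchy_seqs \<and> G \<in> cauchy_seqs \<and>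
     (\<lambda>n. unorm (diff0 (F n) (G n))) \<longlonglongrightarrow> 0}"

definition D :: "qpt set" where
  "D = cauchy_seqs // cauchy_rel"

definition cls :: "(nat \<Rightarrow> hfun) \<Rightarrow> qpt" where
  "cls F = cauchy_rel `` {F}"

text \<open>
  The operations on \<open>D\<close> are the extensions by continuity of those on \<open>D\<^sub>0\<close>, computed on an
  arbitrary representing Cauchy sequence.
\<close>

definition rep :: "qpt \<Rightarrow> nat \<Rightarrow> hfun" where
  "rep a = (SOME F. F \<in> a)"

definition emb :: "hfun \<Rightarrow> qpt" where
  "emb F = cls (\<lambda>n. F)"

definition diffD :: "qpt \<Rightarrow> qpt \<Rightarrow> qpt" where
  "diffD a b = cls (\<lambda>n. diff0 (rep a n) (rep b n))"

definition scaleD :: "complex \<Rightarrow> qpt \<Rightarrow> qpt" where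
  "scaleD z a = cls (\<lambda>n. scale0 z (rep a n))"

definition multD :: "qpt \<Rightarrow> qpt \<Rightarrow> qpt" where
  "multD a b = cls (\<lambda>n. mult0 (rep a n) (rep b n))"

definition starD :: "qpt \<Rightarrow> qpt" where
  "starD a = cls (\<lambda>n. star0 (rep a n))"

definition normD :: "qpt \<Rightarrow> real" where
  "normD a = lim (\<lambda>n. unorm (rep a n))"

definition alpha :: "real ^ 3 \<Rightarrow> qpt \<Rightarrow> qpt" where
  "alpha g a = cls (\<lambda>n. alpha0 g (rep a n))"

definition tau :: "qpt \<Rightarrow> complex" where
  "tau a = lim (\<lambda>n. tau0 (rep a n))"

subsection \<open>Smooth elements and derivations\<close>

definition continuousD :: "(real ^ 3 \<Rightarrow> qpt) \<Rightarrow> bool" where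
  "continuousD f \<longleftrightarrow> (\<forall>g. ((\<lambda>g'. normD (diffD (f g') (f g))) \<longlongrightarrow> 0) (at g))"

definition has_partialD :: "3 \<Rightarrow> (real ^ 3 \<Rightarrow> qpt) \<Rightarrow> qpt \<Rightarrow> real ^ 3 \<Rightarrow> bool" where
  "has_partialD i f d g \<longleftrightarrow> d \<in> D \<and>
     ((\<lambda>h. normD (diffD (scaleD (of_real (1 / h))
         (diffD (f (g + h *\<^sub>R axis i 1)) (f g))) d)) \<longlongrightarrow> 0) (at 0)"

primrec C_k :: "nat \<Rightarrow> (real ^ 3 \<Rightarrow> qpt) \<Rightarrow> bool" where
  "C_k 0 f \<longleftrightarrow> continuousD f"
| "C_k (Suc k) f \<longleftrightarrow> continuousD f \<and>
     (\<forall>i. \<exists>f'. (\<forall>g. has_partialD i f (f' g) g) \<and> C_k k f')"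

definition smoothD :: "qpt set" where
  "smoothD = {a \<in> D. \<forall>k. C_k k (\<lambda>g. alpha g a)}"

text \<open>Each coordinate axis is a one-parameter subgroup of the Heisenberg group
  \<open>(r', s', t') (r, s, t) = (r' + r, s' + s, t' + t + c s' r)\<close>, so its infinitesimal generator
  is the partial derivative at the origin.\<close>

definition deriv_D :: "3 \<Rightarrow> qpt \<Rightarrow> qpt" where
  "deriv_D i a = (THE d. has_partialD i (\<lambda>g. alpha g a) d 0)"

definition unitaryD :: "qpt \<Rightarrow> bool" where
  "unitaryD u \<longleftrightarrow> u \<in> smoothD \<and>
     multD (starD u) u = emb unit0 \<and> multD u (starD u) = emb unit0"

subsection \<open>Cyclic cocycles and the odd pairing\<close>

text \<open>A cochain of degree \<open>n\<close> is applied to the family of its arguments \<open>a 0, \<dots>, a n\<close>.\<close>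

definition phi :: "3 \<Rightarrow> (nat \<Rightarrow> qpt) \<Rightarrow> complex" where
  "phi i a = tau (multD (a 0) (deriv_D i (a 1)))"

definition phi123 :: "(nat \<Rightarrow> qpt) \<Rightarrow> complex" where
  "phi123 a = (\<Sum>\<sigma> | \<sigma> permutes (UNIV :: 3 set). of_int (sign \<sigma>) *
     tau (multD (multD (multD (a 0) (deriv_D (\<sigma> 1) (a 1)))
       (deriv_D (\<sigma> 2) (a 2))) (deriv_D (\<sigma> 3) (a 3))))"

text \<open>
  A \<open>k \<times> k\<close> matrix over \<open>D\<close> is given by its entries with indices below \<open>k\<close>. Writing
  each argument as a sum of its entries tensored with matrix units \<open>E(a,b)\<close>, the trace
  of \<open>E(a 0, b 0) \<cdots> E(a n, b n)\<close> is 1 if \<open>b j = a (j + 1)\<close> for all \<open>j\<close>,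
  with indices taken modulo \<open>n + 1\<close>, and 0 otherwise.
\<close>

definition cup_Tr ::
  "nat \<Rightarrow> nat \<Rightarrow> ((nat \<Rightarrow> qpt) \<Rightarrow> complex) \<Rightarrow> (nat \<Rightarrow> nat \<Rightarrow> nat \<Rightarrow> qpt) \<Rightarrow> complex" where
  "cup_Tr k n \<phi> A =
     (\<Sum>v\<in>{..n} \<rightarrow>\<^sub>E {..<k}. \<phi> (\<lambda>j. A j (v j) (v (Suc j mod Suc n))))"

definition mat_one :: "nat \<Rightarrow> nat \<Rightarrow> qpt" where
  "mat_one i j = (if i = j then emb unit0 else emb zero0)"

definition mat_star :: "(nat \<Rightarrow> nat \<Rightarrow> qpt) \<Rightarrow> nat \<Rightarrow> nat \<Rightarrow> qpt" where
  "mat_star U i j = starD (U j i)"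

definition mat_diff ::
  "(nat \<Rightarrow> nat \<Rightarrow> qpt) \<Rightarrow> (nat \<Rightarrow> nat \<Rightarrow> qpt) \<Rightarrow> nat \<Rightarrow> nat \<Rightarrow> qpt" where
  "mat_diff A B i j = diffD (A i j) (B i j)"

definition pairing ::
  "nat \<Rightarrow> nat \<Rightarrow> (nat \<Rightarrow> nat \<Rightarrow> qpt) \<Rightarrow> ((nat \<Rightarrow> qpt) \<Rightarrow> complex) \<Rightarrow> complex" where
  "pairing k n U \<phi> = (1 / 2 ^ n) / csqrt (2 * \<i>) * inverse (Gamma (of_nat n / 2 + 1)) *
     cup_Tr k n \<phi> (\<lambda>j. if even j then mat_diff (mat_star U) mat_one else mat_diff U mat_one)"

text \<open>An element of \<open>D\<close> is a \<open>1 \<times> 1\<close> matrix over \<open>D\<close>.\<close>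

definition pairing1 :: "nat \<Rightarrow> qpt \<Rightarrow> ((nat \<Rightarrow> qpt) \<Rightarrow> complex) \<Rightarrow> complex" where
  "pairing1 n u \<phi> = pairing 1 n (\<lambda>_ _. u) \<phi>"

end

end

theory Submission
  imports Defs
begin

text \<open>
  Every C*-seminorm on \<open>D\<^sub>0\<close> is at most 1 on unitaries, hence at most the supremum norm on functions
  supported in one degree (the square of such a seminorm at \<open>F\<close> is its value at \<open>F\<^sup>* F\<close>, a function of
  degree 0). So the supremum \<open>unorm\<close> is finite, and it is a seminorm compatible with all operations.
  The regular representation on \<open>\<ell>\<^sup>2(\<int>)\<close> shows that \<open>unorm\<close> dominates the supremum norm in degree 0,
  which makes the trace continuous. On classes of constant sequences all operations on the completion
  are then those of \<open>D\<^sub>0\<close>.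

  The unitaries \<open>U\<^sub>1\<close>, \<open>U\<^sub>2\<close> and their adjoints are eigenvectors of the Heisenberg action for characters
  depending on the single coordinate \<open>r\<close>, respectively \<open>s\<close>. Hence only one of the three derivations
  is non-zero on each of them, and it acts as a scalar. This annihilates every term of the
  degree 3 cocycle and leaves one trace to compute in degree 1.
\<close>

subsection \<open>Matrices acting on finitely supported sequences\<close>

definition fin_seq :: "('a \<Rightarrow> complex) set" where
  "fin_seq = {v. finite {i. v i \<noteq> 0}}"

text \<open>Summing over the support keeps the sum finite over an infinite index type, where a sum
  over the whole type would be 0 by convention. \<open>norm_fs\<close> and \<open>mat_app\<close>
  are encoded in the same way.\<close>

definition inner_fs :: "('a \<Rightarrow> complex) \<Rightarrow> ('a \<Rightarrow> complex) \<Rightarrow> complex" where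
  "inner_fs v w = (\<Sum>i | v i \<noteq> 0. v i * cnj (w i))"

definition norm_fs :: "('a \<Rightarrow> complex) \<Rightarrow> real" where
  "norm_fs v = L2_set (\<lambda>i. cmod (v i)) {i. v i \<noteq> 0}"

definition mat_app :: "('a \<Rightarrow> 'a \<Rightarrow> complex) \<Rightarrow> ('a \<Rightarrow> complex) \<Rightarrow> 'a \<Rightarrow> complex" where
  "mat_app M v i = (\<Sum>j | v j \<noteq> 0. M i j * v j)"

text \<open>The index set is the support of column \<open>j\<close> of the right factor, so this is
  the usual matrix product as soon as \<open>L\<close> has finite columns.\<close>

definition mat_mult :: "('a \<Rightarrow> 'a \<Rightarrow> complex) \<Rightarrow> ('a \<Rightarrow> 'a \<Rightarrow> complex) \<Rightarrow> 'a \<Rightarrow> 'a \<Rightarrow> complex" where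
  "mat_mult M L i j = (\<Sum>k | L k j \<noteq> 0. M i k * L k j)"

definition mat_adj :: "('a \<Rightarrow> 'a \<Rightarrow> complex) \<Rightarrow> 'a \<Rightarrow> 'a \<Rightarrow> complex" where
  "mat_adj M i j = cnj (M j i)"

definition col_finite :: "('a \<Rightarrow> 'a \<Rightarrow> complex) \<Rightarrow> bool" where
  "col_finite M \<longleftrightarrow> (\<forall>j. finite {i. M i j \<noteq> 0})"

definition op_bound :: "('a \<Rightarrow> 'a \<Rightarrow> complex) \<Rightarrow> real \<Rightarrow> bool" where
  "op_bound M K \<longleftrightarrow> 0 \<le> K \<and> (\<forall>v\<in>fin_seq. norm_fs (mat_app M v) \<le> K * norm_fs v)"

text \<open>For an unbounded matrix this is an infimum over the empty set and carries no
  information. The lemmas below therefore take some \<open>op_bound M K\<close> as a witness of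
  boundedness.\<close>

definition op_norm :: "('a \<Rightarrow> 'a \<Rightarrow> complex) \<Rightarrow> real" where
  "op_norm M = Inf {K. op_bound M K}"

lemma inner_fs_eq:
  assumes "finite S" "{i. v i \<noteq> 0} \<subseteq> S"
  shows "inner_fs v w = (\<Sum>i\<in>S. v i * cnj (w i))"
  unfolding inner_fs_def by (rule sum.mono_neutral_left) (use assms in auto)

lemma norm_fs_eq:
  assumes "finite S" "{i. v i \<noteq> 0} \<subseteq> S"
  shows "norm_fs v = L2_set (\<lambda>i. cmod (v i)) S"
  unfolding norm_fs_def L2_set_def
  by (rule arg_cong[where f = sqrt], rule sum.mono_neutral_left) (use assms in auto)

lemma mat_app_eq:
  assumes "finite S" "{i. v i \<noteq> 0} \<subseteq> S"
  shows "mat_app M v i = (\<Sum>j\<in>S. M i j * v j)"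
  unfolding mat_app_def by (rule sum.mono_neutral_left) (use assms in auto)

lemma norm_fs_nonneg: "0 \<le> norm_fs v"
  by (simp add: norm_fs_def L2_set_nonneg)

lemma norm_fs_power2: "complex_of_real ((norm_fs v)\<^sup>2) = inner_fs v v"
  unfolding norm_fs_def inner_fs_def L2_set_def
  by (simp add: sum_nonneg flip: complex_norm_square)

lemma cmod_inner_fs_le:
  assumes "v \<in> fin_seq" "w \<in> fin_seq"
  shows "cmod (inner_fs v w) \<le> norm_fs v * norm_fs w"
proof -
  let ?S = "{i. v i \<noteq> 0} \<union> {i. w i \<noteq> 0}"
  have S: "finite ?S" using assms by (auto simp: fin_seq_def)
  have "cmod (inner_fs v w) \<le> (\<Sum>i\<in>?S. \<bar>cmod (v i)\<bar> * \<bar>cmod (w i)\<bar>)"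
    by (subst inner_fs_eq[OF S]) (auto intro!: order_trans[OF norm_sum] simp: norm_mult)
  also have "\<dots> \<le> L2_set (\<lambda>i. cmod (v i)) ?S * L2_set (\<lambda>i. cmod (w i)) ?S"
    by (rule L2_set_mult_ineq)
  finally show ?thesis using norm_fs_eq[OF S, of v] norm_fs_eq[OF S, of w] by auto
qed

lemma mat_app_fin_seq:
  assumes "col_finite M" "v \<in> fin_seq"
  shows "mat_app M v \<in> fin_seq"
proof -
  have "{i. mat_app M v i \<noteq> 0} \<subseteq> (\<Union>j\<in>{j. v j \<noteq> 0}. {i. M i j \<noteq> 0})"
    by (auto simp: mat_app_def elim!: sum.not_neutral_contains_not_neutral)
  then show ?thesis using assms unfolding fin_seq_def col_finite_def
    by (auto intro: finite_subset)
qed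

text \<open>Both sides are the same double sum over two finite sets, taken in the two
  orders.\<close>

lemma inner_fs_mat_app:
  assumes "col_finite M" "v \<in> fin_seq" "w \<in> fin_seq"
  shows "inner_fs (mat_app M v) w = inner_fs v (mat_app (mat_adj M) w)"
proof -
  let ?A = "{i. mat_app M v i \<noteq> 0} \<union> {i. w i \<noteq> 0}" and ?B = "{i. v i \<noteq> 0}"
  have A: "finite ?A" and B: "finite ?B"
    using assms mat_app_fin_seq[OF assms(1,2)] by (auto simp: fin_seq_def)
  have "inner_fs (mat_app M v) w = (\<Sum>i\<in>?A. \<Sum>j\<in>?B. M i j * v j * cnj (w i))"
    using A B by (subst inner_fs_eq[OF A]) (auto simp: mat_app_def sum_distrib_right)
  also have "\<dots> = (\<Sum>j\<in>?B. \<Sum>i\<in>?A. M i j * v j * cnj (w i))"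
    by (rule sum.swap)
  also have "\<dots> = inner_fs v (mat_app (mat_adj M) w)"
    unfolding inner_fs_def
    by (rule sum.cong[OF refl], subst mat_app_eq[OF A])
      (auto simp: mat_adj_def sum_distrib_left mult_ac)
  finally show ?thesis .
qed

lemma mat_app_mat_mult:
  assumes "col_finite L" "v \<in> fin_seq"
  shows "mat_app (mat_mult M L) v = mat_app M (mat_app L v)"
proof
  fix i
  let ?B = "{j. v j \<noteq> 0}"
  let ?A = "{k. mat_app L v k \<noteq> 0} \<union> (\<Union>j\<in>?B. {k. L k j \<noteq> 0})"
  have B: "finite ?B" using assms by (simp add: fin_seq_def)
  have A: "finite ?A"
    using assms mat_app_fin_seq[OF assms] by (auto simp: fin_seq_def col_finite_def)
  have "mat_app M (mat_app L v) i = (\<Sum>k\<in>?A. \<Sum>j\<in>?B. M i k * L k j * v j)"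
    by (subst mat_app_eq[OF A]) (auto simp: mat_app_def sum_distrib_left mult_ac)
  also have "\<dots> = (\<Sum>j\<in>?B. \<Sum>k\<in>?A. M i k * L k j * v j)"
    by (rule sum.swap)
  also have "\<dots> = (\<Sum>j\<in>?B. mat_mult M L i j * v j)"
  proof (rule sum.cong[OF refl])
    fix j assume j: "j \<in> ?B"
    have "mat_mult M L i j = (\<Sum>k\<in>?A. M i k * L k j)"
      unfolding mat_mult_def by (rule sum.mono_neutral_left[OF A]) (use j in auto)
    then show "(\<Sum>k\<in>?A. M i k * L k j * v j) = mat_mult M L i j * v j"
      by (simp add: sum_distrib_right)
  qed
  finally show "mat_app (mat_mult M L) v i = mat_app M (mat_app L v) i"
    by (simp add: mat_app_def)
qed

lemma norm_fs_add:
  assumes "v \<in> fin_seq" "w \<in> fin_seq"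
  shows "norm_fs (\<lambda>i. v i + w i) \<le> norm_fs v + norm_fs w"
proof -
  let ?S = "{i. v i \<noteq> 0} \<union> {i. w i \<noteq> 0}"
  have S: "finite ?S" using assms by (auto simp: fin_seq_def)
  have "norm_fs (\<lambda>i. v i + w i) = L2_set (\<lambda>i. cmod (v i + w i)) ?S"
    by (rule norm_fs_eq[OF S]) auto
  also have "\<dots> \<le> L2_set (\<lambda>i. cmod (v i) + cmod (w i)) ?S"
    by (rule L2_set_mono) (auto intro: norm_triangle_ineq)
  also have "\<dots> \<le> L2_set (\<lambda>i. cmod (v i)) ?S + L2_set (\<lambda>i. cmod (w i)) ?S"
    by (rule L2_set_triangle_ineq)
  also have "\<dots> = norm_fs v + norm_fs w"
    using norm_fs_eq[OF S, of v] norm_fs_eq[OF S, of w] by auto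
  finally show ?thesis .
qed

lemma norm_fs_scale: "norm_fs (\<lambda>i. z * v i) = cmod z * norm_fs v"
  by (cases "z = 0")
    (auto simp: norm_fs_def L2_set_def norm_mult power_mult_distrib real_sqrt_mult
      simp flip: sum_distrib_left)

section \<open>The operator norm and its C*-identity\<close>

lemma op_norm_nonneg: "op_bound M K \<Longrightarrow> 0 \<le> op_norm M"
  unfolding op_norm_def by (rule cInf_greatest) (auto simp: op_bound_def)

lemma op_norm_le: "op_bound M K \<Longrightarrow> op_norm M \<le> K"
  unfolding op_norm_def
  by (rule cInf_lower) (auto simp: op_bound_def intro: bdd_belowI[of _ 0])

text \<open>The infimum is attained: for each \<open>v\<close> of non-zero norm the quotient
  \<open>norm_fs (mat_app M v) / norm_fs v\<close> is a lower bound of all admissible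
  constants.\<close>

lemma op_bound_op_norm:
  assumes "op_bound M K"
  shows "op_bound M (op_norm M)"
  unfolding op_bound_def
proof (intro conjI ballI)
  show nonneg: "0 \<le> op_norm M" using op_norm_nonneg[OF assms] .
  fix v :: "'a \<Rightarrow> complex" assume v: "v \<in> fin_seq"
  show "norm_fs (mat_app M v) \<le> op_norm M * norm_fs v"
  proof (cases "norm_fs v = 0")
    case True
    then show ?thesis using assms v by (auto simp: op_bound_def)
  next
    case False
    then have pos: "0 < norm_fs v" using norm_fs_nonneg[of v] by simp
    have "norm_fs (mat_app M v) / norm_fs v \<le> op_norm M"
      unfolding op_norm_def
      by (rule cInf_greatest) (use assms v pos in \<open>auto simp: op_bound_def divide_simps\<close>)
    then show ?thesis using pos by (simp add: divide_simps)
  qed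
qed

lemma op_bound_add:
  assumes "col_finite M" "col_finite L" "op_bound M K" "op_bound L K'"
  shows "op_bound (\<lambda>i j. M i j + L i j) (K + K')"
  unfolding op_bound_def
proof (intro conjI ballI)
  show "0 \<le> K + K'" using assms by (simp add: op_bound_def)
  fix v :: "'a \<Rightarrow> complex" assume v: "v \<in> fin_seq"
  have "mat_app (\<lambda>i j. M i j + L i j) v = (\<lambda>i. mat_app M v i + mat_app L v i)"
    by (auto simp: mat_app_def sum.distrib distrib_right)
  then have "norm_fs (mat_app (\<lambda>i j. M i j + L i j) v) \<le> norm_fs (mat_app M v) + norm_fs (mat_app L v)"
    using norm_fs_add mat_app_fin_seq assms v by metis
  also have "\<dots> \<le> (K + K') * norm_fs v"
    using assms v by (auto simp: op_bound_def distrib_right intro!: add_mono)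
  finally show "norm_fs (mat_app (\<lambda>i j. M i j + L i j) v) \<le> (K + K') * norm_fs v" .
qed

lemma op_bound_scale:
  assumes "op_bound M K"
  shows "op_bound (\<lambda>i j. z * M i j) (cmod z * K)"
proof -
  have "mat_app (\<lambda>i j. z * M i j) v = (\<lambda>i. z * mat_app M v i)" for v
    by (auto simp: mat_app_def sum_distrib_left mult_ac)
  then show ?thesis using assms
    by (auto simp: op_bound_def norm_fs_scale mult.assoc intro!: mult_left_mono)
qed

lemma op_norm_scale:
  assumes "op_bound M K"
  shows "op_norm (\<lambda>i j. z * M i j) = cmod z * op_norm M"
proof (rule antisym)
  show "op_norm (\<lambda>i j. z * M i j) \<le> cmod z * op_norm M"
    using op_norm_le[OF op_bound_scale[OF op_bound_op_norm[OF assms]]] .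
  show "cmod z * op_norm M \<le> op_norm (\<lambda>i j. z * M i j)"
  proof (cases "z = 0")
    case True
    then show ?thesis using op_norm_nonneg[OF op_bound_scale[OF assms, of z]] by simp
  next
    case False
    \<comment> \<open>The inequality already shown, applied to the scaled matrix with the factor
      \<open>inverse z\<close>.\<close>
    then have "op_norm M \<le> cmod (inverse z) * op_norm (\<lambda>i j. z * M i j)"
      using op_norm_le[OF op_bound_scale[OF op_bound_op_norm[OF op_bound_scale[OF assms, of z]],
            of "inverse z"]]
      by (simp flip: mult.assoc)
    then show ?thesis using False by (simp add: norm_inverse norm_divide divide_simps mult_ac)
  qed
qed

lemma op_bound_mult:
  assumes "col_finite L" "op_bound M K" "op_bound L K'"
  shows "op_bound (mat_mult M L) (K * K')"
  unfolding op_bound_def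
proof (intro conjI ballI)
  show "0 \<le> K * K'" using assms by (simp add: op_bound_def)
  fix v :: "'a \<Rightarrow> complex" assume v: "v \<in> fin_seq"
  have "norm_fs (mat_app M (mat_app L v)) \<le> K * norm_fs (mat_app L v)"
    using assms mat_app_fin_seq[OF assms(1) v] by (auto simp: op_bound_def)
  also have "\<dots> \<le> K * (K' * norm_fs v)"
    using assms v by (auto simp: op_bound_def intro!: mult_left_mono)
  finally show "norm_fs (mat_app (mat_mult M L) v) \<le> K * K' * norm_fs v"
    by (simp add: mat_app_mat_mult[OF assms(1) v])
qed

text \<open>Move \<open>M\<close> to the other side of the inner product of \<open>M v\<close> with
  itself, then apply Cauchy-Schwarz.\<close>

lemma norm_fs_mat_app_power2:
  assumes "col_finite M" "col_finite (mat_adj M)" "v \<in> fin_seq"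
  shows "(norm_fs (mat_app M v))\<^sup>2 \<le> norm_fs v * norm_fs (mat_app (mat_mult (mat_adj M) M) v)"
proof -
  have Mv: "mat_app M v \<in> fin_seq" using mat_app_fin_seq assms by blast
  have "(norm_fs (mat_app M v))\<^sup>2 = cmod (inner_fs (mat_app M v) (mat_app M v))"
    by (subst norm_fs_power2[symmetric]) (simp add: norm_power)
  also have "\<dots> = cmod (inner_fs v (mat_app (mat_adj M) (mat_app M v)))"
    by (simp add: inner_fs_mat_app[OF assms(1,3) Mv])
  also have "\<dots> \<le> norm_fs v * norm_fs (mat_app (mat_adj M) (mat_app M v))"
    by (intro cmod_inner_fs_le assms mat_app_fin_seq)
  finally show ?thesis by (simp add: mat_app_mat_mult[OF assms(1,3)])
qed

text \<open>This is the hard half of the C*-identity: any bound for M*M bounds the square of the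
  norm of M.\<close>

lemma op_bound_sqrt:
  assumes "col_finite M" "col_finite (mat_adj M)" "op_bound (mat_mult (mat_adj M) M) K"
  shows "op_bound M (sqrt K)"
  unfolding op_bound_def
proof (intro conjI ballI)
  show "0 \<le> sqrt K" using assms by (simp add: op_bound_def)
  fix v :: "'a \<Rightarrow> complex" assume v: "v \<in> fin_seq"
  have "(norm_fs (mat_app M v))\<^sup>2 \<le> norm_fs v * norm_fs (mat_app (mat_mult (mat_adj M) M) v)"
    by (rule norm_fs_mat_app_power2[OF assms(1,2) v])
  also have "\<dots> \<le> norm_fs v * (K * norm_fs v)"
    using assms v by (auto simp: op_bound_def norm_fs_nonneg intro!: mult_left_mono)
  also have "\<dots> = (sqrt K * norm_fs v)\<^sup>2"
    using assms by (simp add: op_bound_def power_mult_distrib power2_eq_square)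
  finally show "norm_fs (mat_app M v) \<le> sqrt K * norm_fs v"
    by (rule power2_le_imp_le) (use assms in \<open>simp add: op_bound_def norm_fs_nonneg\<close>)
qed

lemma mat_adj_mat_adj [simp]: "mat_adj (mat_adj M) = M"
  by (simp add: mat_adj_def fun_eq_iff)

text \<open>Writing |M| for the norm, |M|^2 \<le> |M*M| \<le> |M*| |M|. Cancelling gives |M| \<le>
  |M*|, and the same for M* gives |M| = |M*|, so the chain collapses to equalities.\<close>

lemma op_norm_adj_mult:
  assumes "col_finite M" "col_finite (mat_adj M)" "op_bound M K" "op_bound (mat_adj M) K'"
  shows "op_norm (mat_mult (mat_adj M) M) = (op_norm M)\<^sup>2"
proof -
  \<comment> \<open>Stated for a general \<open>L\<close> because the chain is needed both for
    \<open>M\<close> and for its adjoint.\<close>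
  have *: "(op_norm L)\<^sup>2 \<le> op_norm (mat_mult (mat_adj L) L)"
      "op_norm (mat_mult (mat_adj L) L) \<le> op_norm (mat_adj L) * op_norm L"
    if L: "col_finite L" "col_finite (mat_adj L)" "op_bound L k" "op_bound (mat_adj L) k'"
    for L :: "'a \<Rightarrow> 'a \<Rightarrow> complex" and k k'
  proof -
    have b: "op_bound (mat_mult (mat_adj L) L) (op_norm (mat_adj L) * op_norm L)"
      by (rule op_bound_mult[OF L(1) op_bound_op_norm[OF L(4)] op_bound_op_norm[OF L(3)]])
    then show "op_norm (mat_mult (mat_adj L) L) \<le> op_norm (mat_adj L) * op_norm L"
      by (rule op_norm_le)
    have "op_norm L \<le> sqrt (op_norm (mat_mult (mat_adj L) L))"
      by (rule op_norm_le[OF op_bound_sqrt[OF L(1,2) op_bound_op_norm[OF b]]])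
    then show "(op_norm L)\<^sup>2 \<le> op_norm (mat_mult (mat_adj L) L)"
      using op_norm_nonneg[OF L(3)] op_norm_nonneg[OF b]
      by (metis power_mono real_sqrt_pow2)
  qed
  have le: "op_norm L \<le> op_norm (mat_adj L)"
    if L: "col_finite L" "col_finite (mat_adj L)" "op_bound L k" "op_bound (mat_adj L) k'"
    for L :: "'a \<Rightarrow> 'a \<Rightarrow> complex" and k k'
  proof (cases "op_norm L = 0")
    case True
    then show ?thesis using op_norm_nonneg[OF L(4)] by simp
  next
    case False
    then have "0 < op_norm L" using op_norm_nonneg[OF L(3)] by simp
    moreover have "op_norm L * op_norm L \<le> op_norm (mat_adj L) * op_norm L"
      using *[OF L] by (simp add: power2_eq_square)
    ultimately show ?thesis by simp
  qed
  have "op_norm (mat_adj M) = op_norm M"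
    using le[of M] le[of "mat_adj M"] assms by (intro antisym) auto
  then show ?thesis
    using *[OF assms] by (simp add: power2_eq_square)
qed

text \<open>The entry is one coordinate of the image of the \<open>j\<close>-th basis vector, which
  has norm 1.\<close>

lemma cmod_entry_le_op_norm:
  assumes "col_finite M" "op_bound M K"
  shows "cmod (M i j) \<le> op_norm M"
proof -
  define v :: "'a \<Rightarrow> complex" where "v = (\<lambda>k. if k = j then 1 else 0)"
  have supp: "{k. v k \<noteq> 0} = {j}" by (auto simp: v_def)
  then have v: "v \<in> fin_seq" by (simp add: fin_seq_def)
  have app: "mat_app M v i = M i j" using supp by (simp add: mat_app_def v_def)
  \<comment> \<open>The index \<open>i\<close> is inserted because it lies outside the support when
    the entry itself is 0.\<close>
  let ?S = "insert i {k. mat_app M v k \<noteq> 0}"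
  have S: "finite ?S" using mat_app_fin_seq[OF assms(1) v] by (simp add: fin_seq_def)
  have "cmod (M i j) \<le> L2_set (\<lambda>k. cmod (mat_app M v k)) ?S"
    using member_le_L2_set[OF S, of i "\<lambda>k. cmod (mat_app M v k)"] app by simp
  also have "\<dots> = norm_fs (mat_app M v)" by (rule norm_fs_eq[symmetric, OF S]) auto
  also have "\<dots> \<le> op_norm M * norm_fs v"
    using op_bound_op_norm[OF assms(2)] v by (auto simp: op_bound_def)
  also have "norm_fs v = 1" by (simp add: norm_fs_def supp) (simp add: v_def)
  finally show ?thesis by simp
qed

subsection \<open>The *-algebra of functions\<close>

lemma ee_add: "ee (x + y) = ee x * ee y"
  by (simp add: ee_def distrib_left exp_add)

lemma ee_0 [simp]: "ee 0 = 1"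
  by (simp add: ee_def)

lemma ee_of_int [simp]: "ee (of_int n) = 1"
  unfolding ee_def by (subst exp_eq_1) auto

lemma ee_add_1 [simp]: "ee (x + 1) = ee x"
  using ee_of_int[of 1] by (simp add: ee_add)

lemma cnj_ee [simp]: "cnj (ee x) = ee (- x)"
  by (simp add: ee_def exp_cnj)

lemma cmod_ee [simp]: "cmod (ee x) = 1"
  by (simp add: ee_def norm_exp_eq_Re)

lemma ee_mult_minus [simp]: "ee (- x) * ee x = 1" "ee x * ee (- x) = 1"
  by (simp_all flip: ee_add)

lemma continuous_on_ee [continuous_intros]:
  "continuous_on S f \<Longrightarrow> continuous_on S (\<lambda>x. ee (f x))"
  unfolding ee_def by (intro continuous_intros)

lemma supp_notin: "p \<notin> supp F \<Longrightarrow> F p x y = 0"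
  by (auto simp: supp_def)

lemma supp_add0: "supp (add0 F G) \<subseteq> supp F \<union> supp G"
  by (force simp: supp_def add0_def)

lemma supp_diff0: "supp (diff0 F G) \<subseteq> supp F \<union> supp G"
  by (force simp: supp_def diff0_def)

lemma supp_scale0: "supp (scale0 z F) \<subseteq> supp F"
  by (auto simp: supp_def scale0_def)

lemma diff0_eq_add0: "diff0 F G = add0 F (scale0 (- 1) G)"
  by (simp add: diff0_def add0_def scale0_def)

context quantum_heisenberg
begin

section \<open>Closure of \<open>D0\<close> under the *-algebra operations\<close>

lemma D0_iff: "F \<in> D0 \<longleftrightarrow> finite (supp F) \<and>
     (\<forall>p. continuous_on UNIV (\<lambda>z. F p (fst z) (snd z))) \<and>
     (\<forall>p. \<exists>B. \<forall>x y. cmod (F p x y) \<le> B) \<and>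
     (\<forall>p x y. F p x (y + 1) = F p x y) \<and>
     (\<forall>p x y. F p (x + 1) y =
        ee (- (of_int c * of_int p * (y - of_int p * nu))) * F p x y)"
  by (auto simp: D0_def bounded_iff case_prod_beta' all_conj_distrib)

lemma D0_finite_supp: "F \<in> D0 \<Longrightarrow> finite (supp F)"
  by (simp add: D0_iff)

lemma D0_continuous:
  assumes "F \<in> D0" "continuous_on S f" "continuous_on S g"
  shows "continuous_on S (\<lambda>z. F p (f z) (g z))"
proof -
  have "continuous_on UNIV (\<lambda>z. F p (fst z) (snd z))" using assms by (simp add: D0_iff)
  from continuous_on_compose2[OF this continuous_on_Pair[OF assms(2,3)]] show ?thesis by simp
qed

text \<open>\<open>D0\<close> only bounds each degree separately; since finitely many degrees are
  non-zero, the sum of these bounds serves for all of them.\<close>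

lemma D0_bound:
  assumes "F \<in> D0"
  obtains B where "0 \<le> B" "\<And>p x y. cmod (F p x y) \<le> B"
proof -
  obtain b where b: "\<And>p x y. cmod (F p x y) \<le> b p"
    using assms unfolding D0_iff by metis
  let ?B = "\<Sum>p\<in>supp F. b p"
  have b0: "0 \<le> b p" for p using b[of p 0 0] norm_ge_zero order_trans by blast
  have "cmod (F p x y) \<le> ?B" for p x y
  proof (cases "p \<in> supp F")
    case True
    then have "b p \<le> ?B" using b0 D0_finite_supp[OF assms] by (intro member_le_sum) auto
    then show ?thesis using b order_trans by blast
  next
    case False
    then show ?thesis using b0 by (simp add: supp_notin sum_nonneg)
  qed
  moreover have "0 \<le> ?B" using b0 by (simp add: sum_nonneg)
  ultimately show ?thesis using that by blast
qed

lemma D0_periodic: "F \<in> D0 \<Longrightarrow> F p x (y + 1) = F p x y"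
  by (simp add: D0_iff)

lemma D0_quasiperiodic:
  "F \<in> D0 \<Longrightarrow> F p (x + 1) y = ee (- (of_int c * of_int p * (y - of_int p * nu))) * F p x y"
  by (simp add: D0_iff)

text \<open>Product, involution and action all evaluate functions at translated points; these are
  the two periodicity laws in the shape that then occurs.\<close>

lemma D0_shift:
  assumes "F \<in> D0"
  shows "F p x (y + 1 - a) = F p x (y - a)"
    and "F p (x + 1 - a) y = ee (- (of_int c * of_int p * (y - of_int p * nu))) * F p (x - a) y"
  using D0_periodic[OF assms, of p x "y - a"] D0_quasiperiodic[OF assms, of p "x - a" y]
  by (simp_all add: algebra_simps)

lemma mult0_eq:
  assumes "finite S" "supp F \<subseteq> S"
  shows "mult0 F G p x y =
    (\<Sum>q\<in>S. F q x y * G (p - q) (x - 2 * of_int q * mu) (y - 2 * of_int q * nu))"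
  unfolding mult0_def
  by (rule sum.mono_neutral_left) (use assms in \<open>auto simp: supp_notin\<close>)

lemma zero0_D0: "zero0 \<in> D0"
  by (auto simp: D0_iff zero0_def supp_def)

lemma add0_D0:
  assumes F: "F \<in> D0" and G: "G \<in> D0"
  shows "add0 F G \<in> D0"
  unfolding D0_iff
proof (intro conjI allI)
  show "finite (supp (add0 F G))"
    using finite_subset[OF supp_add0] D0_finite_supp F G by blast
  show "continuous_on UNIV (\<lambda>z. add0 F G p (fst z) (snd z))" for p
    unfolding add0_def by (intro continuous_intros D0_continuous F G)
  show "\<exists>B. \<forall>x y. cmod (add0 F G p x y) \<le> B" for p
  proof -
    obtain B C where "\<And>p x y. cmod (F p x y) \<le> B" "\<And>p x y. cmod (G p x y) \<le> C"
      using D0_bound F G by metis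
    then show ?thesis
      by (intro exI[of _ "B + C"]) (auto simp: add0_def intro!: norm_triangle_le add_mono)
  qed
qed (auto simp: add0_def D0_periodic[OF F] D0_periodic[OF G] D0_quasiperiodic[OF F]
    D0_quasiperiodic[OF G] distrib_left)

lemma scale0_D0:
  assumes F: "F \<in> D0"
  shows "scale0 z F \<in> D0"
  unfolding D0_iff
proof (intro conjI allI)
  show "finite (supp (scale0 z F))"
    using finite_subset[OF supp_scale0] D0_finite_supp F by blast
  show "continuous_on UNIV (\<lambda>w. scale0 z F p (fst w) (snd w))" for p
    unfolding scale0_def by (intro continuous_intros D0_continuous F)
  show "\<exists>B. \<forall>x y. cmod (scale0 z F p x y) \<le> B" for p
  proof -
    obtain B where "\<And>p x y. cmod (F p x y) \<le> B" using D0_bound F by metis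
    then show ?thesis
      by (intro exI[of _ "cmod z * B"]) (auto simp: scale0_def norm_mult intro!: mult_left_mono)
  qed
qed (auto simp: scale0_def D0_periodic[OF F] D0_quasiperiodic[OF F])

lemma diff0_D0: "F \<in> D0 \<Longrightarrow> G \<in> D0 \<Longrightarrow> diff0 F G \<in> D0"
  by (simp add: diff0_eq_add0 add0_D0 scale0_D0)

lemma mult0_D0:
  assumes F: "F \<in> D0" and G: "G \<in> D0"
  shows "mult0 F G \<in> D0"
  unfolding D0_iff
proof (intro conjI allI)
  have "supp (mult0 F G) \<subseteq> (\<lambda>(q, r). q + r) ` (supp F \<times> supp G)"
  proof
    fix p assume "p \<in> supp (mult0 F G)"
    then obtain x y where "mult0 F G p x y \<noteq> 0" by (auto simp: supp_def)
    then obtain q where "q \<in> supp F"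
        "G (p - q) (x - 2 * of_int q * mu) (y - 2 * of_int q * nu) \<noteq> 0"
      unfolding mult0_def
      by (metis (no_types, lifting) mult_zero_right sum.not_neutral_contains_not_neutral)
    then have "q \<in> supp F" "p - q \<in> supp G" by (auto simp: supp_def)
    then show "p \<in> (\<lambda>(q, r). q + r) ` (supp F \<times> supp G)" by force
  qed
  then show "finite (supp (mult0 F G))"
    by (rule finite_subset) (simp add: D0_finite_supp F G)
  show "continuous_on UNIV (\<lambda>z. mult0 F G p (fst z) (snd z))" for p
    unfolding mult0_def by (intro continuous_intros D0_continuous F G)
  show "\<exists>B. \<forall>x y. cmod (mult0 F G p x y) \<le> B" for p
  proof -
    obtain B C where B: "0 \<le> B" "\<And>p x y. cmod (F p x y) \<le> B" "\<And>p x y. cmod (G p x y) \<le> C"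
      using D0_bound[OF F] D0_bound[OF G] by metis
    then have "cmod (mult0 F G p x y) \<le> (\<Sum>q\<in>supp F. B * C)" for x y
      unfolding mult0_def
      by (intro order_trans[OF norm_sum] sum_mono) (auto simp: norm_mult intro!: mult_mono)
    then show ?thesis by blast
  qed
  show "mult0 F G p x (y + 1) = mult0 F G p x y" for p x y
    by (simp add: mult0_def D0_periodic[OF F] D0_shift(1)[OF G])
  show "mult0 F G p (x + 1) y =
      ee (- (of_int c * of_int p * (y - of_int p * nu))) * mult0 F G p x y" for p x y
    unfolding mult0_def sum_distrib_left
  proof (rule sum.cong[OF refl])
    fix q
    \<comment> \<open>The factors of degrees \<open>q\<close> and \<open>p - q\<close> combine to
      that of degree \<open>p\<close>: the translation by \<open>2 * q * nu\<close> turns the second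
      \<open>nu\<close> term into (p - q)(p + q) = p^2 - q^2, and the q^2 cancels.\<close>
    have "ee (- (of_int c * of_int q * (y - of_int q * nu))) *
        ee (- (of_int c * of_int (p - q) * (y - 2 * of_int q * nu - of_int (p - q) * nu))) =
        ee (- (of_int c * of_int p * (y - of_int p * nu)))"
      by (simp flip: ee_add) (simp add: algebra_simps)
    then show "F q (x + 1) y * G (p - q) (x + 1 - 2 * of_int q * mu) (y - 2 * of_int q * nu) =
      ee (- (of_int c * of_int p * (y - of_int p * nu))) *
      (F q x y * G (p - q) (x - 2 * of_int q * mu) (y - 2 * of_int q * nu))"
      unfolding D0_quasiperiodic[OF F] D0_shift(2)[OF G] by (simp add: mult_ac)
  qed
qed

lemma supp_star0: "supp (star0 F) = uminus ` supp F"
proof -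
  have "p \<in> supp (star0 F) \<longleftrightarrow> - p \<in> supp F" for p
  proof -
    have "(\<exists>x y. F (- p) (x - 2 * of_int p * mu) (y - 2 * of_int p * nu) \<noteq> 0) \<longleftrightarrow>
        (\<exists>x y. F (- p) x y \<noteq> 0)"
      by (metis add_diff_cancel)
    then show ?thesis by (simp add: supp_def star0_def)
  qed
  then show ?thesis by force
qed

lemma star0_D0:
  assumes F: "F \<in> D0"
  shows "star0 F \<in> D0"
  unfolding D0_iff
proof (intro conjI allI)
  show "finite (supp (star0 F))" using D0_finite_supp[OF F] by (simp add: supp_star0)
  show "continuous_on UNIV (\<lambda>z. star0 F p (fst z) (snd z))" for p
    unfolding star0_def by (intro continuous_intros D0_continuous F)
  show "\<exists>B. \<forall>x y. cmod (star0 F p x y) \<le> B" for p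
    using D0_bound[OF F] by (metis complex_mod_cnj star0_def)
  show "star0 F p x (y + 1) = star0 F p x y" for p x y
    by (simp add: star0_def D0_shift(1)[OF F])
  show "star0 F p (x + 1) y =
      ee (- (of_int c * of_int p * (y - of_int p * nu))) * star0 F p x y" for p x y
    unfolding star0_def D0_shift(2)[OF F] by (simp add: algebra_simps)
qed

lemma star0_star0: "star0 (star0 F) = F"
  by (simp add: star0_def fun_eq_iff)

section \<open>The Heisenberg action on \<open>D0\<close> by *-automorphisms\<close>

lemma alpha0_eq: "alpha0 g F p x y =
    ee (- (of_int p * (g $ 3 + of_int c * g $ 2 * (x - g $ 1 - of_int p * mu)))) *
      F p (x - g $ 1) (y - g $ 2)"
  by (simp add: alpha0_def Let_def)

lemma supp_alpha0: "supp (alpha0 g F) = supp F"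
proof -
  have "ee x \<noteq> 0" for x by (simp add: ee_def)
  then have "p \<in> supp (alpha0 g F) \<longleftrightarrow> (\<exists>x y. F p (x - g $ 1) (y - g $ 2) \<noteq> 0)" for p
    by (simp add: supp_def alpha0_eq)
  also have "\<dots> p \<longleftrightarrow> p \<in> supp F" for p
    unfolding supp_def mem_Collect_eq by (metis add_diff_cancel)
  finally show ?thesis by blast
qed

lemma alpha0_D0:
  assumes F: "F \<in> D0"
  shows "alpha0 g F \<in> D0"
  unfolding D0_iff
proof (intro conjI allI)
  show "finite (supp (alpha0 g F))" using D0_finite_supp[OF F] by (simp add: supp_alpha0)
  show "continuous_on UNIV (\<lambda>z. alpha0 g F p (fst z) (snd z))" for p
    unfolding alpha0_eq by (intro continuous_intros D0_continuous F)
  show "\<exists>B. \<forall>x y. cmod (alpha0 g F p x y) \<le> B" for p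
    using D0_bound[OF F] by (metis alpha0_eq cmod_ee mult_1 norm_mult)
  show "alpha0 g F p x (y + 1) = alpha0 g F p x y" for p x y
    by (simp add: alpha0_eq D0_shift(1)[OF F])
  show "alpha0 g F p (x + 1) y =
      ee (- (of_int c * of_int p * (y - of_int p * nu))) * alpha0 g F p x y" for p x y
    unfolding alpha0_eq D0_shift(2)[OF F]
    by (simp flip: ee_add mult.assoc) (simp add: algebra_simps)
qed

lemma alpha0_add0: "alpha0 g (add0 F G) = add0 (alpha0 g F) (alpha0 g G)"
  by (simp add: fun_eq_iff alpha0_eq add0_def distrib_left)

lemma alpha0_scale0: "alpha0 g (scale0 z F) = scale0 z (alpha0 g F)"
  by (simp add: fun_eq_iff alpha0_eq scale0_def)

lemma alpha0_diff0: "alpha0 g (diff0 F G) = diff0 (alpha0 g F) (alpha0 g G)"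
  by (simp add: diff0_eq_add0 alpha0_add0 alpha0_scale0)

lemma alpha0_mult0: "alpha0 g (mult0 F G) = mult0 (alpha0 g F) (alpha0 g G)"
proof (intro ext)
  fix p x y
  \<comment> \<open>The phases are multiplicative along the convolution by the cancellation (p -
    q)(p + q) = p^2 - q^2, now in the \<open>mu\<close> terms.\<close>
  have "ee (- (of_int p * (g $ 3 + of_int c * g $ 2 * (x - g $ 1 - of_int p * mu)))) =
     ee (- (of_int q * (g $ 3 + of_int c * g $ 2 * (x - g $ 1 - of_int q * mu)))) *
     ee (- (of_int (p - q) * (g $ 3 + of_int c * g $ 2 *
       (x - 2 * of_int q * mu - g $ 1 - of_int (p - q) * mu))))" for q
    by (simp flip: ee_add) (simp add: algebra_simps)
  then show "alpha0 g (mult0 F G) p x y = mult0 (alpha0 g F) (alpha0 g G) p x y"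
    unfolding mult0_def supp_alpha0 alpha0_eq sum_distrib_left
    by (intro sum.cong refl) (simp add: algebra_simps)
qed

lemma alpha0_star0: "alpha0 g (star0 F) = star0 (alpha0 g F)"
  by (simp add: fun_eq_iff alpha0_eq star0_def algebra_simps)

lemma mult0_diff0_left:
  assumes "F \<in> D0" "F' \<in> D0"
  shows "mult0 (diff0 F F') G = diff0 (mult0 F G) (mult0 F' G)"
proof (intro ext)
  fix p x y
  \<comment> \<open>\<open>mult0\<close> sums over the support of its left factor, which differs
    among the three products; a common index set makes them comparable.\<close>
  let ?S = "supp F \<union> supp F'"
  have S: "finite ?S" using assms D0_finite_supp by blast
  show "mult0 (diff0 F F') G p x y = diff0 (mult0 F G) (mult0 F' G) p x y"
    unfolding diff0_def[of "mult0 F G"]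
    by (subst (1 2 3) mult0_eq[OF S])
      (simp_all add: supp_diff0 sum_subtractf left_diff_distrib, simp_all add: diff0_def
        sum_subtractf left_diff_distrib)
qed

lemma mult0_diff0_right: "mult0 F (diff0 G G') = diff0 (mult0 F G) (mult0 F G')"
  by (simp add: fun_eq_iff mult0_def diff0_def sum_subtractf right_diff_distrib)

lemma star0_diff0: "star0 (diff0 F G) = diff0 (star0 F) (star0 G)"
  by (simp add: fun_eq_iff star0_def diff0_def)

end

subsection \<open>The universal seminorm\<close>

text \<open>Degree 0 is the commutative algebra of functions on the torus, with pointwise product
  and conjugation. It contains \<open>unit0\<close>, \<open>U1\<close> and
  \<open>U2\<close>.\<close>

definition lift0 :: "(real \<Rightarrow> real \<Rightarrow> complex) \<Rightarrow> hfun" where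
  "lift0 f = (\<lambda>p x y. if p = 0 then f x y else 0)"

lemma supp_lift0: "supp (lift0 f) \<subseteq> {0}"
  by (auto simp: supp_def lift0_def split: if_splits)

lemma unit0_eq_lift0: "unit0 = lift0 (\<lambda>x y. 1)"
  by (simp add: unit0_def lift0_def)

lemma U1_eq_lift0: "U1 = lift0 (\<lambda>x y. ee x)"
  by (simp add: U1_def lift0_def)

lemma U2_eq_lift0: "U2 = lift0 (\<lambda>x y. ee y)"
  by (simp add: U2_def lift0_def)

context quantum_heisenberg
begin

lemma lift0_D0:
  assumes "continuous_on UNIV (\<lambda>z. f (fst z) (snd z))" "\<And>x y. cmod (f x y) \<le> B"
    "\<And>x y. f (x + 1) y = f x y" "\<And>x y. f x (y + 1) = f x y"
  shows "lift0 f \<in> D0"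
  unfolding D0_iff
proof (intro conjI allI)
  show "finite (supp (lift0 f))" using supp_lift0 finite_subset by blast
  show "continuous_on UNIV (\<lambda>z. lift0 f p (fst z) (snd z))" for p
    using assms(1) by (cases "p = 0") (simp_all add: lift0_def)
  show "\<exists>B. \<forall>x y. cmod (lift0 f p x y) \<le> B" for p
    using assms(2) by (cases "p = 0") (auto simp: lift0_def)
qed (use assms(3,4) in \<open>simp_all add: lift0_def\<close>)

lemma mult0_lift0_left: "mult0 (lift0 f) G = (\<lambda>p x y. f x y * G p x y)"
  by (intro ext, subst mult0_eq[OF _ supp_lift0]) (simp_all add: lift0_def)

lemma mult0_lift0: "mult0 (lift0 f) (lift0 g) = lift0 (\<lambda>x y. f x y * g x y)"
  by (simp add: mult0_lift0_left fun_eq_iff) (simp add: lift0_def)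

lemma star0_lift0: "star0 (lift0 f) = lift0 (\<lambda>x y. cnj (f x y))"
  by (simp add: star0_def lift0_def fun_eq_iff)

lemma unit0_D0: "unit0 \<in> D0"
  unfolding unit0_eq_lift0 by (rule lift0_D0[where B = 1]) auto

lemma U1_D0: "U1 \<in> D0"
  unfolding U1_eq_lift0 by (rule lift0_D0[where B = 1]) (auto intro!: continuous_intros)

lemma U2_D0: "U2 \<in> D0"
  unfolding U2_eq_lift0 by (rule lift0_D0[where B = 1]) (auto intro!: continuous_intros)

text \<open>An element of \<open>D0\<close> is the finite sum of its homogeneous components, so a
  claim stable under sums need only be checked on functions of one degree.\<close>

lemma D0_induct [consumes 1, case_names single add]:
  assumes "F \<in> D0"
    and single: "\<And>p F. F \<in> D0 \<Longrightarrow> supp F \<subseteq> {p} \<Longrightarrow> P F"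
    and add: "\<And>F G. F \<in> D0 \<Longrightarrow> G \<in> D0 \<Longrightarrow> P F \<Longrightarrow> P G \<Longrightarrow> P (add0 F G)"
  shows "P F"
proof -
  define R :: "int set \<Rightarrow> hfun" where "R S = (\<lambda>p x y. if p \<in> S then F p x y else 0)" for S
  have supp_R: "supp (R S) \<subseteq> S" "supp (R S) \<subseteq> supp F" for S
    by (auto simp: supp_def R_def split: if_splits)
  have R: "R S \<in> D0" for S
    unfolding D0_iff
  proof (intro conjI allI)
    show "finite (supp (R S))"
      using supp_R(2) D0_finite_supp[OF assms(1)] by (rule finite_subset)
    show "continuous_on UNIV (\<lambda>z. R S p (fst z) (snd z))" for p
      using assms(1) by (cases "p \<in> S") (simp_all add: R_def D0_iff)
    show "\<exists>B. \<forall>x y. cmod (R S p x y) \<le> B" for p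
      using assms(1) by (cases "p \<in> S") (auto simp: R_def D0_iff)
  qed (auto simp: R_def D0_periodic[OF assms(1)] D0_quasiperiodic[OF assms(1)])
  have "P (R S)" if "finite S" for S
    using that
  proof induction
    case empty
    \<comment> \<open>With no degrees left the component is zero, and its support lies in
      \<open>{p}\<close> for any \<open>p\<close>, so the single-degree case covers it.\<close>
    then show ?case using single[OF R] supp_R(1)[of "{}"] by blast
  next
    case (insert p S)
    then have "R (insert p S) = add0 (R {p}) (R S)"
      by (auto simp: R_def add0_def fun_eq_iff)
    then show ?case using add[OF R R single[OF R supp_R(1)] insert.IH] by simp
  qed
  moreover have "R (supp F) = F" by (auto simp: R_def fun_eq_iff supp_notin)
  ultimately show ?thesis using D0_finite_supp[OF assms(1)] by metis
qed

section \<open>Uniform bounds for all C*-seminorms at a given function\<close>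

lemma cstar_seminormD:
  assumes "cstar_seminorm N" "F \<in> D0"
  shows "0 \<le> N F" "N (scale0 z F) = cmod z * N F" "N (mult0 (star0 F) F) = (N F)\<^sup>2"
    and "G \<in> D0 \<Longrightarrow> N (add0 F G) \<le> N F + N G" "G \<in> D0 \<Longrightarrow> N (mult0 F G) \<le> N F * N G"
  using assms by (simp_all add: cstar_seminorm_def)

text \<open>The C*-identity at the unit makes \<open>N unit0\<close> equal to its own square, hence
  at most 1; at \<open>u\<close> it gives \<open>(N u)\<^sup>2 = N unit0\<close>.\<close>

lemma cstar_seminorm_unitary:
  assumes N: "cstar_seminorm N" and u: "u \<in> D0" "mult0 (star0 u) u = unit0"
  shows "N u \<le> 1"
proof -
  have sq: "N (mult0 (star0 F) F) = (N F)\<^sup>2" if "F \<in> D0" for F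
    using N that by (simp add: cstar_seminorm_def)
  have "mult0 (star0 unit0) unit0 = unit0" by (simp add: unit0_eq_lift0 mult0_lift0 star0_lift0)
  then have "N unit0 = (N unit0)\<^sup>2" using sq[OF unit0_D0] by simp
  then have "N unit0 \<le> 1" by (auto simp: power2_eq_square)
  then have "(N u)\<^sup>2 \<le> 1" using sq[OF u(1)] u(2) by simp
  then show ?thesis using abs_square_le_1[of "N u"] by simp
qed

text \<open>A real function \<open>r\<close> bounded by 1 is the mean of the unitaries \<open>r \<plusminus> \<i> sqrt (1 - r\<^sup>2)\<close>.\<close>

lemma cstar_seminorm_lift0_le_1:
  assumes N: "cstar_seminorm N" and h: "lift0 (\<lambda>x y. of_real (r x y)) \<in> D0"
    and r: "\<And>x y. \<bar>r x y\<bar> \<le> 1"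
  shows "N (lift0 (\<lambda>x y. of_real (r x y))) \<le> 1"
proof -
  let ?h = "lift0 (\<lambda>x y. of_real (r x y))"
  \<comment> \<open>Continuity and periodicity of \<open>r\<close> are read off from membership in
    \<open>D0\<close> at degree 0, where the quasi-periodicity factor is 1.\<close>
  have cont: "continuous_on UNIV (\<lambda>z. r (fst z) (snd z))"
    using continuous_on_Re[OF D0_continuous[OF h continuous_on_fst[OF continuous_on_id]
          continuous_on_snd[OF continuous_on_id], of UNIV 0]]
    by (simp add: lift0_def)
  have per: "r (x + 1) y = r x y" "r x (y + 1) = r x y" for x y
    using D0_quasiperiodic[OF h, of 0 x y] D0_periodic[OF h, of 0 x y] by (simp_all add: lift0_def)
  have r2: "(r x y)\<^sup>2 \<le> 1" for x y using r[of x y] by (simp add: abs_square_le_1)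
  define f where "f s x y = Complex (r x y) (s * sqrt (1 - (r x y)\<^sup>2))" for s x y
  have norm_f: "f s x y * cnj (f s x y) = 1" "cmod (f s x y) = 1" if "s\<^sup>2 = 1" for s x y
    using that r2[of x y]
    by (simp_all add: f_def complex_eq_iff cmod_def power_mult_distrib flip: power2_eq_square)
  have f: "lift0 (f s) \<in> D0" if "s\<^sup>2 = 1" for s
  proof (rule lift0_D0)
    show "continuous_on UNIV (\<lambda>z. f s (fst z) (snd z))"
      unfolding f_def by (intro continuous_intros cont)
    show "cmod (f s x y) \<le> 1" for x y using norm_f(2)[OF that] by simp
  qed (simp_all add: f_def per)
  have Nf: "N (lift0 (f s)) \<le> 1" if "s\<^sup>2 = 1" for s
    by (rule cstar_seminorm_unitary[OF N f[OF that]])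
      (use norm_f(1)[OF that] in \<open>simp add: star0_lift0 mult0_lift0 unit0_eq_lift0 mult.commute\<close>)
  have "?h = scale0 (1/2) (add0 (lift0 (f 1)) (lift0 (f (- 1))))"
    by (simp add: lift0_def scale0_def add0_def f_def fun_eq_iff complex_eq_iff)
  then have "N ?h = 1/2 * N (add0 (lift0 (f 1)) (lift0 (f (- 1))))"
    using N f[of 1] f[of "- 1"] by (simp add: cstar_seminorm_def add0_D0)
  also have "\<dots> \<le> 1/2 * (N (lift0 (f 1)) + N (lift0 (f (- 1))))"
    using N f[of 1] f[of "- 1"] by (simp add: cstar_seminorm_def)
  also have "\<dots> \<le> 1" using Nf[of 1] Nf[of "- 1"] by simp
  finally show ?thesis .
qed

text \<open>The degrees \<open>- p\<close> and \<open>p\<close> cancel, so F*F is a non-negative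
  function on the torus, to which the bound for real functions applies after scaling.\<close>

lemma star0_mult0_single:
  assumes "supp F \<subseteq> {p}"
  shows "mult0 (star0 F) F =
    lift0 (\<lambda>x y. of_real ((cmod (F p (x + 2 * of_int p * mu) (y + 2 * of_int p * nu)))\<^sup>2))"
proof (intro ext)
  fix q x y
  have "supp (star0 F) \<subseteq> {- p}" using assms by (auto simp: supp_star0)
  then have "mult0 (star0 F) F q x y =
      cnj (F p (x + 2 * of_int p * mu) (y + 2 * of_int p * nu)) *
      F (q + p) (x + 2 * of_int p * mu) (y + 2 * of_int p * nu)"
    by (subst mult0_eq[of "{- p}"]) (auto simp: star0_def)
  moreover have "F (q + p) x y = 0" if "q \<noteq> 0" for x y
    using assms that by (intro supp_notin) auto
  ultimately show "mult0 (star0 F) F q x y = lift0 (\<lambda>x y.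
      of_real ((cmod (F p (x + 2 * of_int p * mu) (y + 2 * of_int p * nu)))\<^sup>2)) q x y"
    by (cases "q = 0") (simp_all add: lift0_def complex_norm_square mult.commute flip: of_real_power)
qed

text \<open>Makes the supremum defining \<open>unorm\<close> finite. In one degree the bound comes
  from the C*-identity and the sup norm; subadditivity extends it to finite sums.\<close>

lemma cstar_seminorms_bounded:
  assumes "F \<in> D0"
  shows "\<exists>B. \<forall>N. cstar_seminorm N \<longrightarrow> N F \<le> B"
  using assms
proof (induction rule: D0_induct)
  case (single p F)
  obtain B' where B': "0 \<le> B'" "\<And>p x y. cmod (F p x y) \<le> B'" using D0_bound[OF single(1)] by metis
  \<comment> \<open>The added 1 makes the bound strictly positive, so that it can be divided
    by.\<close>
  define B where "B = B' + 1"
  have B: "0 < B" "\<And>p x y. cmod (F p x y) \<le> B"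
    using B' by (auto simp: B_def intro: order_trans[of _ B'])
  let ?G = "\<lambda>x y. F p (x + 2 * of_int p * mu) (y + 2 * of_int p * nu)"
  let ?r = "\<lambda>x y. (cmod (?G x y) / B)\<^sup>2"
  let ?h = "lift0 (\<lambda>x y. of_real (?r x y))"
  have eq: "mult0 (star0 F) F = scale0 (of_real (B\<^sup>2)) ?h"
    unfolding star0_mult0_single[OF single(2)] using B
    by (simp add: scale0_def lift0_def fun_eq_iff power_divide)
  \<comment> \<open>Read as a multiple of F*F, the normalised function is in \<open>D0\<close>
    without a separate check of continuity and periodicity.\<close>
  have "?h = scale0 (of_real (1 / B\<^sup>2)) (mult0 (star0 F) F)"
    unfolding eq using B by (simp add: scale0_def fun_eq_iff)
  then have h: "?h \<in> D0" by (simp add: scale0_D0 mult0_D0 star0_D0 single)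
  have "N F \<le> B" if N: "cstar_seminorm N" for N
  proof -
    have "N ?h \<le> 1"
      by (rule cstar_seminorm_lift0_le_1[OF N h])
        (use B in \<open>simp add: power_divide divide_le_eq_1 power_mono\<close>)
    moreover have "(N F)\<^sup>2 = B\<^sup>2 * N ?h"
    proof -
      have "N (mult0 (star0 F) F) = (N F)\<^sup>2" "N (scale0 (of_real (B\<^sup>2)) ?h) = cmod (of_real (B\<^sup>2)) * N ?h"
        using N single(1) h by (simp_all only: cstar_seminorm_def)
      then show ?thesis unfolding eq by (simp only: norm_of_real abs_power2)
    qed
    ultimately have "(N F)\<^sup>2 \<le> B\<^sup>2" by (simp add: mult_left_le)
    then show ?thesis by (rule power2_le_imp_le) (use B in simp)
  qed
  then show ?case by blast
next
  case (add F G)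
  then obtain B C where "\<forall>N. cstar_seminorm N \<longrightarrow> N F \<le> B" "\<forall>N. cstar_seminorm N \<longrightarrow> N G \<le> C"
    by blast
  then have "\<forall>N. cstar_seminorm N \<longrightarrow> N (add0 F G) \<le> B + C"
    using cstar_seminormD(4)[OF _ add(1,2)] by (meson add_mono order_trans)
  then show ?case by blast
qed

text \<open>The regular representation of \<open>D\<^sub>0\<close> on \<open>\<ell>\<^sup>2(\<int>)\<close> along the orbit of a point of the torus.\<close>

definition reg_mat :: "real \<Rightarrow> real \<Rightarrow> hfun \<Rightarrow> int \<Rightarrow> int \<Rightarrow> complex" where
  "reg_mat x y F i j = F (i - j) (x + 2 * of_int i * mu) (y + 2 * of_int i * nu)"

lemma col_finite_reg_mat:
  assumes "F \<in> D0"
  shows "col_finite (reg_mat x y F)"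
  unfolding col_finite_def
proof
  fix j
  have "{i. reg_mat x y F i j \<noteq> 0} \<subseteq> (\<lambda>q. q + j) ` supp F"
  proof
    fix i assume "i \<in> {i. reg_mat x y F i j \<noteq> 0}"
    then have "i - j \<in> supp F" using supp_notin by (auto simp: reg_mat_def)
    then show "i \<in> (\<lambda>q. q + j) ` supp F" by force
  qed
  then show "finite {i. reg_mat x y F i j \<noteq> 0}"
    by (rule finite_subset) (simp add: D0_finite_supp assms)
qed

text \<open>The base point moves with the row index; the translation by \<open>2 * (i - j)\<close>
  in \<open>star0\<close> takes it from row \<open>i\<close> to row \<open>j\<close>, which is the
  transposition.\<close>

lemma reg_mat_star0: "reg_mat x y (star0 F) = mat_adj (reg_mat x y F)"
  by (simp add: fun_eq_iff mat_adj_def reg_mat_def star0_def algebra_simps)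

lemma reg_mat_mult0:
  assumes F: "F \<in> D0" and G: "G \<in> D0"
  shows "reg_mat x y (mult0 F G) = mat_mult (reg_mat x y F) (reg_mat x y G)"
proof (intro ext)
  fix i j
  \<comment> \<open>A finite set holding both the rows where column \<open>j\<close> of
    \<open>G\<close> is non-zero and all \<open>i - q\<close> with \<open>q\<close> in the support
    of \<open>F\<close>. The substitution \<open>k = i - q\<close> then matches matrix product and
    convolution.\<close>
  let ?K = "{k. reg_mat x y G k j \<noteq> 0} \<union> (\<lambda>q. i - q) ` supp F"
  have K: "finite ?K"
    using col_finite_reg_mat[OF G] D0_finite_supp[OF F] by (simp add: col_finite_def)
  have "mat_mult (reg_mat x y F) (reg_mat x y G) i j =
      (\<Sum>k\<in>?K. reg_mat x y F i k * reg_mat x y G k j)"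
    unfolding mat_mult_def by (rule sum.mono_neutral_left[OF K]) auto
  also have "\<dots> = (\<Sum>k\<in>(\<lambda>q. i - q) ` supp F. reg_mat x y F i k * reg_mat x y G k j)"
  proof (rule sum.mono_neutral_right[OF K])
    show "\<forall>k\<in>?K - (\<lambda>q. i - q) ` supp F. reg_mat x y F i k * reg_mat x y G k j = 0"
    proof
      fix k assume "k \<in> ?K - (\<lambda>q. i - q) ` supp F"
      then have "i - k \<notin> supp F" by (auto simp: image_iff)
      then show "reg_mat x y F i k * reg_mat x y G k j = 0"
        by (simp add: reg_mat_def supp_notin)
    qed
  qed auto
  also have "\<dots> = (\<Sum>q\<in>supp F. reg_mat x y F i (i - q) * reg_mat x y G (i - q) j)"
    by (subst sum.reindex) (auto simp: inj_on_def)
  also have "\<dots> = reg_mat x y (mult0 F G) i j"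
    unfolding reg_mat_def mult0_def by (rule sum.cong) (simp_all add: algebra_simps)
  finally show "reg_mat x y (mult0 F G) i j = mat_mult (reg_mat x y F) (reg_mat x y G) i j" ..
qed

text \<open>A function of degree \<open>p\<close> acts as a weighted shift by \<open>p\<close> with
  weights bounded by its sup norm; general elements are finite sums of these.\<close>

lemma op_bound_reg_mat:
  assumes "F \<in> D0"
  shows "\<exists>K. op_bound (reg_mat x y F) K"
  using assms
proof (induction rule: D0_induct)
  case (single p F)
  obtain B where B: "0 \<le> B" "\<And>p x y. cmod (F p x y) \<le> B" using D0_bound[OF single(1)] by metis
  have "norm_fs (mat_app (reg_mat x y F) v) \<le> B * norm_fs v" if v: "v \<in> fin_seq" for v
  proof -
    let ?S = "{j. v j \<noteq> 0}"
    let ?T = "(\<lambda>j. j + p) ` ?S"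
    have S: "finite ?S" using v by (simp add: fin_seq_def)
    \<comment> \<open>Row \<open>i\<close> has at most one non-zero entry, in column
      \<open>i - p\<close>.\<close>
    have app: "mat_app (reg_mat x y F) v i = reg_mat x y F i (i - p) * v (i - p)" for i
    proof -
      have "reg_mat x y F i j = 0" if "j \<noteq> i - p" for j
        unfolding reg_mat_def by (rule supp_notin) (use single(2) that in auto)
      then have "mat_app (reg_mat x y F) v i = (\<Sum>j\<in>{i - p}. reg_mat x y F i j * v j)"
        unfolding mat_app_eq[OF finite.insertI[OF S, of "i - p"] subset_insertI]
        by (intro sum.mono_neutral_right) (use S in auto)
      then show ?thesis by simp
    qed
    have "norm_fs (mat_app (reg_mat x y F) v) = L2_set (\<lambda>i. cmod (mat_app (reg_mat x y F) v i)) ?T"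
      by (rule norm_fs_eq) (use S in \<open>auto simp: app image_iff intro!: exI[of _ "_ - p"]\<close>)
    also have "\<dots> \<le> L2_set (\<lambda>i. B * cmod (v (i - p))) ?T"
      by (rule L2_set_mono) (use B in \<open>auto simp: app norm_mult reg_mat_def intro!: mult_right_mono\<close>)
    also have "\<dots> = B * L2_set (\<lambda>i. cmod (v (i - p))) ?T"
      using B by (simp add: L2_set_right_distrib)
    also have "L2_set (\<lambda>i. cmod (v (i - p))) ?T = norm_fs v"
      unfolding norm_fs_def L2_set_def by (subst sum.reindex) (auto simp: inj_on_def)
    finally show ?thesis .
  qed
  then show ?case using B by (auto simp: op_bound_def)
next
  case (add F G)
  have "reg_mat x y (add0 F G) = (\<lambda>i j. reg_mat x y F i j + reg_mat x y G i j)"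
    by (simp add: fun_eq_iff reg_mat_def add0_def)
  then show ?case using add op_bound_add col_finite_reg_mat by metis
qed

text \<open>Serves twice: it shows that the set of C*-seminorms is non-empty, and it bounds
  \<open>unorm\<close> from below.\<close>

lemma cstar_seminorm_reg_mat: "cstar_seminorm (\<lambda>F. op_norm (reg_mat x y F))"
  unfolding cstar_seminorm_def
proof (intro conjI ballI allI)
  fix F assume F: "F \<in> D0"
  obtain K where K: "op_bound (reg_mat x y F) K" using op_bound_reg_mat[OF F] ..
  show "0 \<le> op_norm (reg_mat x y F)" using op_norm_nonneg[OF K] .
  have "reg_mat x y (scale0 z F) = (\<lambda>i j. z * reg_mat x y F i j)" for z
    by (simp add: fun_eq_iff reg_mat_def scale0_def)
  then show "op_norm (reg_mat x y (scale0 z F)) = cmod z * op_norm (reg_mat x y F)" for z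
    using op_norm_scale[OF K] by simp
  obtain K' where K': "op_bound (reg_mat x y (star0 F)) K'" using op_bound_reg_mat[OF star0_D0[OF F]] ..
  show "op_norm (reg_mat x y (mult0 (star0 F) F)) = (op_norm (reg_mat x y F))\<^sup>2"
    using op_norm_adj_mult[OF col_finite_reg_mat[OF F] _ K] col_finite_reg_mat[OF star0_D0[OF F]] K'
    by (simp add: reg_mat_mult0 F star0_D0 reg_mat_star0)
  fix G assume G: "G \<in> D0"
  obtain L where L: "op_bound (reg_mat x y G) L" using op_bound_reg_mat[OF G] ..
  have "reg_mat x y (add0 F G) = (\<lambda>i j. reg_mat x y F i j + reg_mat x y G i j)"
    by (simp add: fun_eq_iff reg_mat_def add0_def)
  then show "op_norm (reg_mat x y (add0 F G)) \<le> op_norm (reg_mat x y F) + op_norm (reg_mat x y G)"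
    using op_norm_le[OF op_bound_add[OF col_finite_reg_mat[OF F] col_finite_reg_mat[OF G]
          op_bound_op_norm[OF K] op_bound_op_norm[OF L]]]
    by simp
  show "op_norm (reg_mat x y (mult0 F G)) \<le> op_norm (reg_mat x y F) * op_norm (reg_mat x y G)"
    using op_norm_le[OF op_bound_mult[OF col_finite_reg_mat[OF G] op_bound_op_norm[OF K]
          op_bound_op_norm[OF L]]]
    by (simp add: reg_mat_mult0 F G)
qed

section \<open>The supremum of all C*-seminorms and its compatibility with the operations\<close>

lemma cstar_seminorm_le_unorm:
  assumes "cstar_seminorm N" "F \<in> D0"
  shows "N F \<le> unorm F"
  unfolding unorm_def
  using cstar_seminorms_bounded[OF assms(2)] assms(1)
  by (intro cSup_upper) (auto simp: bdd_above_def)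

text \<open>A supremum of reals has this property only over a non-empty set, which the regular
  representation supplies.\<close>

lemma unorm_least:
  assumes "\<And>N. cstar_seminorm N \<Longrightarrow> N F \<le> K"
  shows "unorm F \<le> K"
  unfolding unorm_def
  using cstar_seminorm_reg_mat assms by (intro cSup_least) auto

lemma unorm_nonneg:
  assumes "F \<in> D0"
  shows "0 \<le> unorm F"
  using cstar_seminorm_le_unorm[OF cstar_seminorm_reg_mat assms] cstar_seminorm_reg_mat assms
  unfolding cstar_seminorm_def by (meson order_trans)

lemma unorm_add0:
  assumes "F \<in> D0" "G \<in> D0"
  shows "unorm (add0 F G) \<le> unorm F + unorm G"
proof (rule unorm_least)
  fix N assume N: "cstar_seminorm N"
  then have "N (add0 F G) \<le> N F + N G" using assms by (simp add: cstar_seminorm_def)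
  also have "\<dots> \<le> unorm F + unorm G" by (intro add_mono cstar_seminorm_le_unorm N assms)
  finally show "N (add0 F G) \<le> unorm F + unorm G" .
qed

lemma unorm_mult0:
  assumes "F \<in> D0" "G \<in> D0"
  shows "unorm (mult0 F G) \<le> unorm F * unorm G"
proof (rule unorm_least)
  fix N assume N: "cstar_seminorm N"
  then have "N (mult0 F G) \<le> N F * N G" using assms by (simp add: cstar_seminorm_def)
  also have "\<dots> \<le> unorm F * unorm G"
    using N assms by (intro mult_mono cstar_seminorm_le_unorm unorm_nonneg)
      (auto simp: cstar_seminorm_def)
  finally show "N (mult0 F G) \<le> unorm F * unorm G" .
qed

lemma unorm_scale0_le:
  assumes "F \<in> D0"
  shows "unorm (scale0 z F) \<le> cmod z * unorm F"
proof (rule unorm_least)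
  fix N assume N: "cstar_seminorm N"
  then have "N (scale0 z F) = cmod z * N F" using assms by (simp add: cstar_seminorm_def)
  then show "N (scale0 z F) \<le> cmod z * unorm F"
    using cstar_seminorm_le_unorm[OF N assms] by (simp add: mult_left_mono)
qed

lemma unorm_scale0:
  assumes F: "F \<in> D0"
  shows "unorm (scale0 z F) = cmod z * unorm F"
proof (rule antisym[OF unorm_scale0_le[OF F]])
  show "cmod z * unorm F \<le> unorm (scale0 z F)"
  proof (cases "z = 0")
    case True
    then show ?thesis using unorm_nonneg[OF scale0_D0[OF F]] by simp
  next
    case False
    then have "scale0 (inverse z) (scale0 z F) = F" by (simp add: scale0_def fun_eq_iff)
    then have "unorm F \<le> cmod (inverse z) * unorm (scale0 z F)"
      using unorm_scale0_le[OF scale0_D0[OF F], of "inverse z" z] by simp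
    then show ?thesis using False by (simp add: norm_inverse norm_divide field_simps)
  qed
qed

lemma unorm_star0_le:
  assumes F: "F \<in> D0"
  shows "unorm (star0 F) \<le> unorm F"
proof (rule unorm_least)
  fix N assume N: "cstar_seminorm N"
  have sF: "star0 F \<in> D0" using star0_D0[OF F] .
  have "(N (star0 F))\<^sup>2 = N (mult0 F (star0 F))"
    using N sF unfolding cstar_seminorm_def by (metis star0_star0)
  also have "\<dots> \<le> N F * N (star0 F)" using N F sF by (simp add: cstar_seminorm_def)
  finally have "N (star0 F) * N (star0 F) \<le> N F * N (star0 F)" by (simp add: power2_eq_square)
  moreover have "0 \<le> N (star0 F)" "0 \<le> N F" using N F sF by (simp_all add: cstar_seminorm_def)
  ultimately have "N (star0 F) \<le> N F" by (cases "N (star0 F) = 0") auto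
  also have "\<dots> \<le> unorm F" by (rule cstar_seminorm_le_unorm[OF N F])
  finally show "N (star0 F) \<le> unorm F" .
qed

text \<open>Composing a C*-seminorm with the *-automorphism \<open>alpha0 g\<close> yields another
  C*-seminorm, which already competes in the supremum.\<close>

lemma unorm_alpha0_le:
  assumes F: "F \<in> D0"
  shows "unorm (alpha0 g F) \<le> unorm F"
proof (rule unorm_least)
  fix N assume N: "cstar_seminorm N"
  then have "cstar_seminorm (\<lambda>F. N (alpha0 g F))"
    unfolding cstar_seminorm_def[of "\<lambda>F. N (alpha0 g F)"]
      alpha0_add0 alpha0_scale0 alpha0_mult0 alpha0_star0
    by (intro conjI ballI allI cstar_seminormD alpha0_D0)
  then show "N (alpha0 g F) \<le> unorm F" by (rule cstar_seminorm_le_unorm[OF _ F])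
qed

text \<open>The value is the entry at (0, 0) of the regular representation along the orbit of (x,
  y). This is what makes the trace continuous.\<close>

lemma cmod_le_unorm:
  assumes F: "F \<in> D0"
  shows "cmod (F 0 x y) \<le> unorm F"
proof -
  obtain K where "op_bound (reg_mat x y F) K" using op_bound_reg_mat[OF F] ..
  then have "cmod (reg_mat x y F 0 0) \<le> op_norm (reg_mat x y F)"
    by (rule cmod_entry_le_op_norm[OF col_finite_reg_mat[OF F]])
  also have "\<dots> \<le> unorm F" by (rule cstar_seminorm_le_unorm[OF cstar_seminorm_reg_mat F])
  finally show ?thesis by (simp add: reg_mat_def)
qed

lemma unorm_diff0_self: "unorm (diff0 F F) = 0"
  using unorm_scale0[OF zero0_D0, of 0] by (simp add: diff0_def scale0_def zero0_def)

lemma unorm_diff0_commute: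
  assumes "F \<in> D0" "G \<in> D0"
  shows "unorm (diff0 F G) = unorm (diff0 G F)"
proof -
  have "diff0 F G = scale0 (- 1) (diff0 G F)" by (simp add: diff0_def scale0_def fun_eq_iff)
  then show ?thesis using assms by (simp add: unorm_scale0 diff0_D0)
qed

lemma unorm_diff0_triangle:
  assumes "F \<in> D0" "G \<in> D0" "H \<in> D0"
  shows "unorm (diff0 F H) \<le> unorm (diff0 F G) + unorm (diff0 G H)"
proof -
  have "diff0 F H = add0 (diff0 F G) (diff0 G H)" by (simp add: diff0_def add0_def)
  then show ?thesis using unorm_add0 assms by (simp add: diff0_D0)
qed

lemma unorm_le_diff0:
  assumes "F \<in> D0" "G \<in> D0"
  shows "\<bar>unorm F - unorm G\<bar> \<le> unorm (diff0 F G)"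
proof -
  have "unorm F \<le> unorm (diff0 F G) + unorm G" if "F \<in> D0" "G \<in> D0" for F G
  proof -
    have "F = add0 (diff0 F G) G" by (simp add: diff0_def add0_def)
    then show ?thesis using unorm_add0[OF diff0_D0[OF that] that(2)] by simp
  qed
  from this[of F G] this[of G F] show ?thesis
    using assms unorm_diff0_commute[OF assms] by simp
qed

end

subsection \<open>Elements of the completion\<close>

context quantum_heisenberg
begin

section \<open>The completion as a quotient of Cauchy sequences\<close>

lemma cauchy_seqs_D0: "F \<in> cauchy_seqs \<Longrightarrow> F n \<in> D0"
  by (simp add: cauchy_seqs_def)

lemma cauchy_seqs_Cauchy:
  "F \<in> cauchy_seqs \<Longrightarrow> 0 < e \<Longrightarrow> \<exists>M. \<forall>m\<ge>M. \<forall>n\<ge>M. unorm (diff0 (F m) (F n)) < e"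
  by (simp add: cauchy_seqs_def)

lemma unorm_diff0_null:
  assumes "\<And>n. F n \<in> D0" "\<And>n. G n \<in> D0" "\<And>n. unorm (diff0 (F n) (G n)) \<le> e n"
    "e \<longlonglongrightarrow> 0"
  shows "(\<lambda>n. unorm (diff0 (F n) (G n))) \<longlonglongrightarrow> 0"
proof (rule real_tendsto_sandwich[OF _ _ tendsto_const assms(4)])
  show "\<forall>\<^sub>F n in sequentially. 0 \<le> unorm (diff0 (F n) (G n))"
    by (simp add: assms(1,2) unorm_nonneg diff0_D0)
  show "\<forall>\<^sub>F n in sequentially. unorm (diff0 (F n) (G n)) \<le> e n"
    by (simp add: assms(3))
qed

lemma cauchy_relI:
  "F \<in> cauchy_seqs \<Longrightarrow> G \<in> cauchy_seqs \<Longrightarrow> (\<lambda>n. unorm (diff0 (F n) (G n))) \<longlonglongrightarrow> 0 \<Longrightarrow>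
    (F, G) \<in> cauchy_rel"
  by (simp add: cauchy_rel_def)

lemma equiv_cauchy_rel: "equiv cauchy_seqs cauchy_rel"
proof (rule equivI)
  show "cauchy_rel \<subseteq> cauchy_seqs \<times> cauchy_seqs" by (auto simp: cauchy_rel_def)
  show "refl_on cauchy_seqs cauchy_rel"
    by (auto simp: refl_on_def cauchy_rel_def unorm_diff0_self)
  show "sym cauchy_rel"
  proof (rule symI)
    fix F G assume "(F, G) \<in> cauchy_rel"
    then show "(G, F) \<in> cauchy_rel"
      using unorm_diff0_commute[OF cauchy_seqs_D0 cauchy_seqs_D0, of F G]
      by (simp add: cauchy_rel_def)
  qed
  show "trans cauchy_rel"
  proof (rule transI)
    fix F G H assume FG: "(F, G) \<in> cauchy_rel" and GH: "(G, H) \<in> cauchy_rel"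
    then have D0: "F n \<in> D0" "G n \<in> D0" "H n \<in> D0" for n
      by (auto simp: cauchy_rel_def cauchy_seqs_D0)
    have "(\<lambda>n. unorm (diff0 (F n) (G n)) + unorm (diff0 (G n) (H n))) \<longlonglongrightarrow> 0 + 0"
      using FG GH by (intro tendsto_add) (auto simp: cauchy_rel_def)
    then have "(\<lambda>n. unorm (diff0 (F n) (H n))) \<longlonglongrightarrow> 0"
      by (intro unorm_diff0_null[OF D0(1) D0(3) unorm_diff0_triangle[OF D0]]) simp
    then show "(F, H) \<in> cauchy_rel" using FG GH by (auto simp: cauchy_rel_def)
  qed
qed

lemma cls_eqI:
  assumes "F \<in> cauchy_seqs" "G \<in> cauchy_seqs" "(\<lambda>n. unorm (diff0 (F n) (G n))) \<longlonglongrightarrow> 0"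
  shows "cls F = cls G"
  unfolding cls_def using equiv_class_eq[OF equiv_cauchy_rel cauchy_relI[OF assms]] .

lemma cls_D: "F \<in> cauchy_seqs \<Longrightarrow> cls F \<in> D"
  unfolding cls_def D_def by (rule quotientI)

lemma rep_in: "a \<in> D \<Longrightarrow> rep a \<in> a"
  unfolding rep_def some_in_eq D_def by (rule in_quotient_imp_non_empty[OF equiv_cauchy_rel])

lemma rep_cauchy: "a \<in> D \<Longrightarrow> rep a \<in> cauchy_seqs"
  using rep_in[of a] in_quotient_imp_subset[OF equiv_cauchy_rel, of a] by (auto simp: D_def)

lemma rep_D0: "a \<in> D \<Longrightarrow> rep a n \<in> D0"
  by (rule cauchy_seqs_D0[OF rep_cauchy])

lemma cls_rep: "a \<in> D \<Longrightarrow> cls (rep a) = a"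
proof -
  assume a: "a \<in> D"
  then obtain F where F: "a = cauchy_rel `` {F}" unfolding D_def by (rule quotientE)
  then have "(F, rep a) \<in> cauchy_rel" using rep_in[OF a] by simp
  then show "cls (rep a) = a"
    unfolding cls_def F by (rule equiv_class_eq[OF equiv_cauchy_rel, symmetric])
qed

text \<open>Every operation on the completion goes through the chosen representative
  \<open>rep\<close>; this controls that choice up to a null sequence.\<close>

lemma rep_cls:
  assumes "F \<in> cauchy_seqs"
  shows "(\<lambda>n. unorm (diff0 (rep (cls F) n) (F n))) \<longlonglongrightarrow> 0"
proof -
  have "(F, rep (cls F)) \<in> cauchy_rel" using rep_in[OF cls_D[OF assms]] by (simp add: cls_def)
  then have "(rep (cls F), F) \<in> cauchy_rel"
    using equiv_cauchy_rel by (simp add: equiv_def symD)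
  then show ?thesis by (simp add: cauchy_rel_def)
qed

lemma normD_cls:
  assumes F: "F \<in> cauchy_seqs"
  shows "(\<lambda>n. unorm (F n)) \<longlonglongrightarrow> normD (cls F)"
proof -
  \<comment> \<open>\<open>normD\<close> is defined by \<open>lim\<close>, so convergence has to be
    established first; the reverse triangle inequality makes the norms a Cauchy sequence.\<close>
  have conv: "(\<lambda>n. unorm (G n)) \<longlonglongrightarrow> lim (\<lambda>n. unorm (G n))" if G: "G \<in> cauchy_seqs" for G
  proof -
    have "Cauchy (\<lambda>n. unorm (G n))"
    proof (rule metric_CauchyI)
      fix e :: real assume "0 < e"
      then obtain M where M: "\<And>m n. M \<le> m \<Longrightarrow> M \<le> n \<Longrightarrow> unorm (diff0 (G m) (G n)) < e"
        using cauchy_seqs_Cauchy[OF G] by metis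
      show "\<exists>M. \<forall>m\<ge>M. \<forall>n\<ge>M. dist (unorm (G m)) (unorm (G n)) < e"
        using unorm_le_diff0[OF cauchy_seqs_D0[OF G] cauchy_seqs_D0[OF G]] M
        unfolding dist_real_def by (meson le_less_trans)
    qed
    then show ?thesis using Cauchy_convergent convergent_LIMSEQ_iff by blast
  qed
  let ?R = "rep (cls F)"
  have R: "?R \<in> cauchy_seqs" using rep_cauchy[OF cls_D[OF F]] .
  have "(\<lambda>n. unorm (?R n) - unorm (F n)) \<longlonglongrightarrow> 0"
    using rep_cls[OF F]
    by (rule Lim_null_comparison[rotated])
      (simp add: unorm_le_diff0 cauchy_seqs_D0[OF F] cauchy_seqs_D0[OF R])
  then have "(\<lambda>n. unorm (?R n) - (unorm (?R n) - unorm (F n))) \<longlonglongrightarrow> lim (\<lambda>n. unorm (?R n)) - 0"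
    by (intro tendsto_diff conv R)
  then show ?thesis by (simp add: normD_def)
qed

lemma diff0_diff0_le:
  assumes "F \<in> D0" "G \<in> D0" "F' \<in> D0" "G' \<in> D0"
  shows "unorm (diff0 (diff0 F G) (diff0 F' G')) \<le> unorm (diff0 F F') + unorm (diff0 G G')"
proof -
  have eq: "diff0 (diff0 F G) (diff0 F' G') = add0 (diff0 F F') (scale0 (- 1) (diff0 G G'))"
    by (simp add: diff0_def add0_def scale0_def fun_eq_iff)
  have "unorm (add0 (diff0 F F') (scale0 (- 1) (diff0 G G'))) \<le>
      unorm (diff0 F F') + unorm (scale0 (- 1) (diff0 G G'))"
    by (intro unorm_add0 scale0_D0 diff0_D0 assms)
  then show ?thesis unfolding eq using assms by (simp add: unorm_scale0 diff0_D0)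
qed

lemma diff0_cauchy:
  assumes F: "F \<in> cauchy_seqs" and G: "G \<in> cauchy_seqs"
  shows "(\<lambda>n. diff0 (F n) (G n)) \<in> cauchy_seqs"
  unfolding cauchy_seqs_def mem_Collect_eq
proof (intro conjI allI impI)
  show "diff0 (F n) (G n) \<in> D0" for n by (intro diff0_D0 cauchy_seqs_D0 F G)
  fix e :: real assume "0 < e"
  then have e: "0 < e / 2" by simp
  obtain M where M: "\<And>m n. M \<le> m \<Longrightarrow> M \<le> n \<Longrightarrow> unorm (diff0 (F m) (F n)) < e / 2"
    using cauchy_seqs_Cauchy[OF F e] by blast
  obtain M' where M': "\<And>m n. M' \<le> m \<Longrightarrow> M' \<le> n \<Longrightarrow> unorm (diff0 (G m) (G n)) < e / 2"
    using cauchy_seqs_Cauchy[OF G e] by blast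
  have "unorm (diff0 (diff0 (F m) (G m)) (diff0 (F n) (G n))) < e"
    if "max M M' \<le> m" "max M M' \<le> n" for m n
  proof -
    have "unorm (diff0 (diff0 (F m) (G m)) (diff0 (F n) (G n))) \<le>
        unorm (diff0 (F m) (F n)) + unorm (diff0 (G m) (G n))"
      by (intro diff0_diff0_le cauchy_seqs_D0 F G)
    then show ?thesis using M[of m n] M'[of m n] that by simp
  qed
  then show "\<exists>M. \<forall>m\<ge>M. \<forall>n\<ge>M. unorm (diff0 (diff0 (F m) (G m)) (diff0 (F n) (G n))) < e"
    by blast
qed

lemma normD_diffD:
  assumes "a \<in> D" "b \<in> D"
  shows "(\<lambda>n. unorm (diff0 (rep a n) (rep b n))) \<longlonglongrightarrow> normD (diffD a b)"
  unfolding diffD_def by (intro normD_cls diff0_cauchy rep_cauchy assms)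

lemma normD_diffD_nonneg: "a \<in> D \<Longrightarrow> b \<in> D \<Longrightarrow> 0 \<le> normD (diffD a b)"
  by (rule LIMSEQ_le_const[OF normD_diffD]) (simp_all add: unorm_nonneg diff0_D0 rep_D0)

text \<open>The intermediate point stands first in both terms because it will be a difference
  quotient compared with two candidate derivatives.\<close>

lemma normD_diffD_le:
  assumes "a \<in> D" "b \<in> D" "d \<in> D"
  shows "normD (diffD a b) \<le> normD (diffD d a) + normD (diffD d b)"
proof (rule LIMSEQ_le[OF normD_diffD[OF assms(1,2)]
      tendsto_add[OF normD_diffD[OF assms(3,1)] normD_diffD[OF assms(3,2)]]])
  have "unorm (diff0 (rep a n) (rep b n)) \<le>
      unorm (diff0 (rep d n) (rep a n)) + unorm (diff0 (rep d n) (rep b n))" for n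
    using unorm_diff0_triangle[of "rep a n" "rep d n" "rep b n"]
      unorm_diff0_commute[of "rep a n" "rep d n"] assms
    by (simp add: rep_D0)
  then show "\<exists>N. \<forall>n\<ge>N. unorm (diff0 (rep a n) (rep b n)) \<le>
      unorm (diff0 (rep d n) (rep a n)) + unorm (diff0 (rep d n) (rep b n))"
    by blast
qed

lemma normD_diffD_eq_0:
  assumes "a \<in> D" "b \<in> D" "normD (diffD a b) = 0"
  shows "a = b"
  using cls_eqI[OF rep_cauchy[OF assms(1)] rep_cauchy[OF assms(2)]]
    normD_diffD[OF assms(1,2)] assms cls_rep by simp

section \<open>Operations on classes of constant sequences\<close>

lemma const_cauchy: "X \<in> D0 \<Longrightarrow> (\<lambda>n. X) \<in> cauchy_seqs"
  by (simp add: cauchy_seqs_def unorm_diff0_self)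

lemma emb_D: "X \<in> D0 \<Longrightarrow> emb X \<in> D"
  unfolding emb_def by (intro cls_D const_cauchy)

lemma rep_emb: "X \<in> D0 \<Longrightarrow> (\<lambda>n. unorm (diff0 (rep (emb X) n) X)) \<longlonglongrightarrow> 0"
  unfolding emb_def by (rule rep_cls[OF const_cauchy])

lemma rep_emb_D0: "X \<in> D0 \<Longrightarrow> rep (emb X) n \<in> D0"
  by (rule rep_D0[OF emb_D])

text \<open>One estimate against a fixed \<open>X\<close> gives both that the sequence is Cauchy and
  that its class is that of \<open>X\<close>. The transfer lemmas below reduce to this.\<close>

lemma cls_eq_emb:
  assumes F: "\<And>n. F n \<in> D0" and X: "X \<in> D0"
    and le: "\<And>n. unorm (diff0 (F n) X) \<le> e n" and e: "e \<longlonglongrightarrow> 0"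
  shows "cls F = emb X"
proof -
  note lim = unorm_diff0_null[of F "\<lambda>n. X", OF F X le e]
  have "F \<in> cauchy_seqs"
    unfolding cauchy_seqs_def mem_Collect_eq
  proof (intro conjI allI impI F)
    fix e :: real assume "0 < e"
    then obtain M where M: "\<And>n. M \<le> n \<Longrightarrow> \<bar>unorm (diff0 (F n) X)\<bar> < e / 2"
      using LIMSEQ_D[OF lim, of "e / 2"] by auto
    have "unorm (diff0 (F m) (F n)) < e" if "M \<le> m" "M \<le> n" for m n
      using unorm_diff0_triangle[OF F X F, of m n] unorm_diff0_commute[OF F X, of n] M[OF that(1)]
        M[OF that(2)] by simp
    then show "\<exists>M. \<forall>m\<ge>M. \<forall>n\<ge>M. unorm (diff0 (F m) (F n)) < e" by blast
  qed
  then show ?thesis unfolding emb_def by (rule cls_eqI[OF _ const_cauchy[OF X] lim])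
qed

lemma diffD_emb:
  assumes X: "X \<in> D0" and Y: "Y \<in> D0"
  shows "diffD (emb X) (emb Y) = emb (diff0 X Y)"
proof -
  let ?F = "rep (emb X)" and ?G = "rep (emb Y)"
  have D0: "?F n \<in> D0" "?G n \<in> D0" for n using X Y by (simp_all add: rep_emb_D0)
  have "(\<lambda>n. unorm (diff0 (?F n) X) + unorm (diff0 (?G n) Y)) \<longlonglongrightarrow> 0"
    using tendsto_add[OF rep_emb[OF X] rep_emb[OF Y]] by simp
  then show ?thesis unfolding diffD_def
    by (rule cls_eq_emb[OF diff0_D0[OF D0] diff0_D0[OF X Y] diff0_diff0_le[OF D0 X Y]])
qed

lemma scaleD_emb:
  assumes X: "X \<in> D0"
  shows "scaleD z (emb X) = emb (scale0 z X)"
proof -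
  let ?F = "rep (emb X)"
  have F: "?F n \<in> D0" for n by (rule rep_emb_D0[OF X])
  have "diff0 (scale0 z (?F n)) (scale0 z X) = scale0 z (diff0 (?F n) X)" for n
    by (simp add: diff0_def scale0_def fun_eq_iff right_diff_distrib)
  then have le: "unorm (diff0 (scale0 z (?F n)) (scale0 z X)) \<le> cmod z * unorm (diff0 (?F n) X)" for n
    using unorm_scale0_le[OF diff0_D0[OF F X]] by simp
  show ?thesis unfolding scaleD_def
    by (rule cls_eq_emb[OF scale0_D0[OF F] scale0_D0[OF X] le tendsto_mult_right_zero[OF rep_emb[OF X]]])
qed

lemma starD_emb:
  assumes X: "X \<in> D0"
  shows "starD (emb X) = emb (star0 X)"
proof -
  let ?F = "rep (emb X)"
  have F: "?F n \<in> D0" for n by (rule rep_emb_D0[OF X])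
  have le: "unorm (diff0 (star0 (?F n)) (star0 X)) \<le> unorm (diff0 (?F n) X)" for n
    using unorm_star0_le[OF diff0_D0[OF F X]] by (simp add: star0_diff0)
  show ?thesis unfolding starD_def
    by (rule cls_eq_emb[OF star0_D0[OF F] star0_D0[OF X] le rep_emb[OF X]])
qed

lemma alpha_emb:
  assumes X: "X \<in> D0"
  shows "alpha g (emb X) = emb (alpha0 g X)"
proof -
  let ?F = "rep (emb X)"
  have F: "?F n \<in> D0" for n by (rule rep_emb_D0[OF X])
  have le: "unorm (diff0 (alpha0 g (?F n)) (alpha0 g X)) \<le> unorm (diff0 (?F n) X)" for n
    using unorm_alpha0_le[OF diff0_D0[OF F X]] by (simp add: alpha0_diff0)
  show ?thesis unfolding alpha_def
    by (rule cls_eq_emb[OF alpha0_D0[OF F] alpha0_D0[OF X] le rep_emb[OF X]])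
qed

lemma normD_emb: "X \<in> D0 \<Longrightarrow> normD (emb X) = unorm X"
  unfolding emb_def by (rule LIMSEQ_unique[OF normD_cls[OF const_cauchy] tendsto_const])

lemma multD_emb:
  assumes X: "X \<in> D0" and Y: "Y \<in> D0"
  shows "multD (emb X) (emb Y) = emb (mult0 X Y)"
proof -
  let ?F = "rep (emb X)" and ?G = "rep (emb Y)"
  \<comment> \<open>The bound comes from splitting the error as (F_n - X) G_n + X (G_n - Y). It
    tends to 0 because the norms of G_n converge and so stay bounded.\<close>
  let ?e = "\<lambda>n. unorm (diff0 (?F n) X) * unorm (?G n) + unorm X * unorm (diff0 (?G n) Y)"
  have D0: "?F n \<in> D0" "?G n \<in> D0" for n using X Y by (simp_all add: rep_emb_D0)
  have le: "unorm (diff0 (mult0 (?F n) (?G n)) (mult0 X Y)) \<le> ?e n" for n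
  proof -
    have eq: "diff0 (mult0 (?F n) (?G n)) (mult0 X Y) =
        add0 (mult0 (diff0 (?F n) X) (?G n)) (mult0 X (diff0 (?G n) Y))"
      unfolding mult0_diff0_left[OF D0(1) X] mult0_diff0_right
      by (simp add: add0_def diff0_def fun_eq_iff)
    have D0': "diff0 (?F n) X \<in> D0" "diff0 (?G n) Y \<in> D0"
      by (simp_all add: diff0_D0 D0 X Y)
    show ?thesis unfolding eq
      by (rule order_trans[OF unorm_add0[OF mult0_D0[OF D0'(1) D0(2)] mult0_D0[OF X D0'(2)]]
            add_mono[OF unorm_mult0[OF D0'(1) D0(2)] unorm_mult0[OF X D0'(2)]]])
  qed
  have "(\<lambda>n. unorm (?G n)) \<longlonglongrightarrow> normD (emb Y)"
    using normD_cls[OF rep_cauchy[OF emb_D[OF Y]]] by (simp add: cls_rep emb_D Y)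
  then have "?e \<longlonglongrightarrow> 0 * normD (emb Y) + unorm X * 0"
    by (intro tendsto_intros rep_emb X Y)
  then have "?e \<longlonglongrightarrow> 0" by simp
  then show ?thesis unfolding multD_def
    by (rule cls_eq_emb[OF mult0_D0[OF D0] mult0_D0[OF X Y] le])
qed

section \<open>The trace on embedded functions\<close>

lemma integrable_D0:
  assumes "F \<in> D0"
  shows "(\<lambda>y. F p x y) integrable_on {0..1}"
    and "(\<lambda>x. integral {0..1} (\<lambda>y. F p x y)) integrable_on {0..1}"
proof -
  show "(\<lambda>y. F p x y) integrable_on {0..1}"
    by (intro integrable_continuous_real D0_continuous[OF assms] continuous_intros)
  have "continuous_on ({0..1} \<times> cbox 0 1) (\<lambda>(x, y). F p x y)"
    unfolding case_prod_beta' by (intro D0_continuous[OF assms] continuous_intros)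
  from integral_continuous_on_param[OF this]
  show "(\<lambda>x. integral {0..1} (\<lambda>y. F p x y)) integrable_on {0..1}"
    by (intro integrable_continuous_real) simp
qed

lemma tau0_diff0:
  assumes "F \<in> D0" "G \<in> D0"
  shows "tau0 (diff0 F G) = tau0 F - tau0 G"
  unfolding tau0_def diff0_def using assms
  by (simp add: integrable_D0 Henstock_Kurzweil_Integration.integral_diff)

lemma tau0_scale0: "tau0 (scale0 z F) = z * tau0 F"
  by (simp add: tau0_def scale0_def)

text \<open>The trace averages the degree 0 part over the unit square, where every value is at most
  \<open>unorm F\<close> in modulus.\<close>

lemma cmod_tau0_le:
  assumes F: "F \<in> D0"
  shows "cmod (tau0 F) \<le> unorm F"
proof -
  have le: "cmod (integral {0..1} (\<lambda>y. F 0 x y)) \<le> unorm F" for x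
    using integral_bound[of 0 1 "\<lambda>y. F 0 x y" "unorm F"] cmod_le_unorm[OF F]
    by (simp add: D0_continuous[OF F])
  have "cmod (tau0 F) \<le> integral {0..1::real} (\<lambda>x. unorm F)"
    unfolding tau0_def
    by (rule Henstock_Kurzweil_Integration.integral_norm_bound_integral)
      (simp_all add: integrable_D0[OF F] le integrable_const_ivl)
  then show ?thesis by simp
qed

lemma tau_emb:
  assumes X: "X \<in> D0"
  shows "tau (emb X) = tau0 X"
  unfolding tau_def
proof (rule limI)
  have "(\<lambda>n. tau0 (rep (emb X) n) - tau0 X) \<longlonglongrightarrow> 0"
  proof (rule Lim_null_comparison[OF _ rep_emb[OF X]], rule always_eventually, rule allI)
    fix n
    show "cmod (tau0 (rep (emb X) n) - tau0 X) \<le> unorm (diff0 (rep (emb X) n) X)"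
      using cmod_tau0_le[OF diff0_D0[OF rep_emb_D0[OF X] X]] tau0_diff0[OF rep_emb_D0[OF X] X]
      by simp
  qed
  then show "(\<lambda>n. tau0 (rep (emb X) n)) \<longlonglongrightarrow> tau0 X" by (simp add: LIM_zero_iff)
qed

end

subsection \<open>Smoothness and derivatives of eigenvectors\<close>

lemma ee_tendsto_deriv:
  "((\<lambda>h. of_real (1 / h) * (ee (a + b * h) - ee a)) \<longlongrightarrow> 2 * of_real pi * \<i> * of_real b * ee a) (at 0)"
proof -
  \<comment> \<open>The exponential is differentiated as a function of a complex variable, and the
    limit is then restricted to real increments.\<close>
  define f :: "complex \<Rightarrow> complex" where
    "f z = exp (2 * of_real pi * \<i> * (of_real a + of_real b * z))" for z
  have f_ee: "f (of_real h) = ee (a + b * h)" for h by (simp add: f_def ee_def)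
  have "(f has_field_derivative 2 * of_real pi * \<i> * of_real b * ee a) (at 0)"
    unfolding f_def ee_def by (auto intro!: derivative_eq_intros)
  then have "((\<lambda>z. (f (0 + z) - f 0) / z) \<longlongrightarrow> 2 * of_real pi * \<i> * of_real b * ee a) (at 0)"
    by (simp add: DERIV_def)
  moreover have "filterlim complex_of_real (at 0) (at 0)"
    by (rule filterlim_atI) (auto intro!: tendsto_eq_intros eventually_neq_at_within)
  ultimately have "((\<lambda>h. (f (0 + of_real h) - f 0) / of_real h) \<longlongrightarrow>
      2 * of_real pi * \<i> * of_real b * ee a) (at 0)"
    by (rule filterlim_compose)
  then show ?thesis
    using f_ee[of 0] by (simp add: f_ee)
qed

lemma ee_tendsto:
  fixes f :: "'a \<Rightarrow> real"
  assumes "(f \<longlongrightarrow> a) F"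
  shows "((\<lambda>x. ee (f x)) \<longlongrightarrow> ee a) F"
  unfolding ee_def by (intro tendsto_intros assms)

context quantum_heisenberg
begin

lemma has_partialD_emb:
  assumes f: "\<And>g. f g = emb (\<Phi> g)" and \<Phi>: "\<And>g. \<Phi> g \<in> D0" and W: "W \<in> D0"
  shows "has_partialD i f (emb W) g \<longleftrightarrow>
    ((\<lambda>h. unorm (diff0 (scale0 (of_real (1 / h)) (diff0 (\<Phi> (g + h *\<^sub>R axis i 1)) (\<Phi> g))) W))
      \<longlongrightarrow> 0) (at 0)"
  by (simp add: has_partialD_def emb_D W f diffD_emb scaleD_emb normD_emb \<Phi> diff0_D0 scale0_D0)

text \<open>\<open>deriv_D\<close> is a definite description, so it can be evaluated only once
  derivatives are known to be unique.\<close>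

lemma has_partialD_unique:
  assumes f: "\<And>g. f g = emb (\<Phi> g)" and \<Phi>: "\<And>g. \<Phi> g \<in> D0"
    and d: "has_partialD i f d g" "has_partialD i f d' g"
  shows "d = d'"
proof -
  let ?Q = "\<lambda>h. scaleD (of_real (1 / h)) (diffD (f (g + h *\<^sub>R axis i 1)) (f g))"
  have Q: "?Q h \<in> D" for h
    by (simp add: f diffD_emb scaleD_emb \<Phi> diff0_D0 scale0_D0 emb_D)
  have D: "d \<in> D" "d' \<in> D" using d by (simp_all add: has_partialD_def)
  have lim: "((\<lambda>h. normD (diffD (?Q h) d) + normD (diffD (?Q h) d')) \<longlongrightarrow> 0) (at 0)"
    using d by (auto simp: has_partialD_def intro: tendsto_add_zero)
  have "normD (diffD d d') \<le> 0"
  proof (rule tendsto_lowerbound[OF lim])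
    show "\<forall>\<^sub>F h in at 0. normD (diffD d d') \<le> normD (diffD (?Q h) d) + normD (diffD (?Q h) d')"
      using normD_diffD_le[OF D Q] by (rule always_eventually[OF allI])
  qed simp
  then show ?thesis
    using normD_diffD_eq_0[OF D] normD_diffD_nonneg[OF D] by simp
qed

lemma deriv_D_emb:
  assumes "X \<in> D0" "W \<in> D0" "has_partialD i (\<lambda>g. alpha g (emb X)) (emb W) 0"
  shows "deriv_D i (emb X) = emb W"
  unfolding deriv_D_def
proof (rule the_equality)
  show "has_partialD i (\<lambda>g. alpha g (emb X)) (emb W) 0" by (rule assms(3))
  fix d assume "has_partialD i (\<lambda>g. alpha g (emb X)) d 0"
  from has_partialD_unique[OF alpha_emb[OF assms(1)] alpha0_D0[OF assms(1)] this assms(3)]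
  show "d = emb W" .
qed

text \<open>The constant summand \<open>W\<close> drops out of every difference; it is there for the
  -1 in the arguments of the pairing. The derivative has the same shape with another constant in
  place of \<open>z\<close>, so it can be differentiated again.\<close>

lemma has_partialD_character:
  assumes V: "V \<in> D0" and W: "W \<in> D0"
  shows "has_partialD i (\<lambda>g. emb (add0 (scale0 (z * ee (k * g $ j)) V) W))
    (emb (scale0 (z * (if i = j then 2 * of_real pi * \<i> * of_real k else 0) * ee (k * g $ j)) V)) g"
proof -
  \<comment> \<open>A step \<open>h\<close> along axis \<open>i\<close> changes the phase by
    \<open>b * h\<close>, so that \<open>b = 0\<close> covers the directions other than
    \<open>j\<close>.\<close>
  define b where "b = (if i = j then k else 0)"
  define z' where "z' = z * (if i = j then 2 * of_real pi * \<i> * of_real k else 0) * ee (k * g $ j)"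
  let ?q = "\<lambda>h. of_real (1 / h) * (ee (k * g $ j + b * h) - ee (k * g $ j))"
  have z': "z' = z * (2 * of_real pi * \<i> * of_real b * ee (k * g $ j))"
    by (simp add: z'_def b_def)
  have "((\<lambda>h. cmod (z * ?q h - z') * unorm V) \<longlongrightarrow> 0) (at 0)"
    unfolding z'
    by (intro tendsto_mult_left_zero tendsto_norm_zero LIM_zero tendsto_mult_left ee_tendsto_deriv)
  moreover have "unorm (diff0 (scale0 (of_real (1 / h))
        (diff0 (add0 (scale0 (z * ee (k * (g + h *\<^sub>R axis i 1) $ j)) V) W)
          (add0 (scale0 (z * ee (k * g $ j)) V) W))) (scale0 z' V)) = cmod (z * ?q h - z') * unorm V" for h
  proof -
    have "ee (k * (g + h *\<^sub>R axis i 1) $ j) = ee (k * g $ j + b * h)"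
      by (simp add: b_def axis_def distrib_left)
    then have "diff0 (scale0 (of_real (1 / h))
        (diff0 (add0 (scale0 (z * ee (k * (g + h *\<^sub>R axis i 1) $ j)) V) W)
          (add0 (scale0 (z * ee (k * g $ j)) V) W))) (scale0 z' V) = scale0 (z * ?q h - z') V"
      by (simp add: diff0_def add0_def scale0_def fun_eq_iff algebra_simps)
    then show ?thesis by (simp only: unorm_scale0[OF V])
  qed
  ultimately show ?thesis
    unfolding z'_def[symmetric]
    by (subst has_partialD_emb[OF refl]) (simp_all add: add0_D0 scale0_D0 V W)
qed

lemma continuousD_character:
  assumes V: "V \<in> D0"
  shows "continuousD (\<lambda>g. emb (scale0 (z * ee (k * g $ j)) V))"
  unfolding continuousD_def
proof
  fix g :: "real ^ 3"
  have eq: "normD (diffD (emb (scale0 (z * ee (k * g' $ j)) V)) (emb (scale0 (z * ee (k * g $ j)) V))) =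
      cmod (z * ee (k * g' $ j) - z * ee (k * g $ j)) * unorm V" for g' :: "real ^ 3"
  proof -
    have "diff0 (scale0 (z * ee (k * g' $ j)) V) (scale0 (z * ee (k * g $ j)) V) =
        scale0 (z * ee (k * g' $ j) - z * ee (k * g $ j)) V"
      by (simp add: diff0_def scale0_def fun_eq_iff algebra_simps)
    then show ?thesis
      by (simp only: diffD_emb normD_emb unorm_scale0 scale0_D0 V)
  qed
  show "((\<lambda>g'. normD (diffD (emb (scale0 (z * ee (k * g' $ j)) V)) (emb (scale0 (z * ee (k * g $ j)) V))))
      \<longlongrightarrow> 0) (at g)"
    unfolding eq
    by (intro tendsto_mult_left_zero tendsto_norm_zero LIM_zero tendsto_mult_left ee_tendsto tendsto_intros)
qed

text \<open>The constant \<open>z\<close> is generalised because each partial derivative is the same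
  map with \<open>z\<close> multiplied by a scalar.\<close>

lemma C_k_character:
  assumes V: "V \<in> D0"
  shows "C_k n (\<lambda>g. emb (scale0 (z * ee (k * g $ j)) V))"
proof (induction n arbitrary: z)
  case 0
  then show ?case by (simp add: continuousD_character V)
next
  case (Suc n)
  have add_zero: "add0 F zero0 = F" for F by (simp add: add0_def zero0_def)
  show ?case
    unfolding C_k.simps
  proof (intro conjI allI)
    fix i
    show "\<exists>f'. (\<forall>g. has_partialD i (\<lambda>g. emb (scale0 (z * ee (k * g $ j)) V)) (f' g) g) \<and> C_k n f'"
      using has_partialD_character[OF V zero0_D0, of i z k j, unfolded add_zero] Suc.IH
      by (intro exI conjI allI)
  qed (rule continuousD_character[OF V])
qed

section \<open>Eigenvectors of the Heisenberg action\<close>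

definition eigenvector :: "3 \<Rightarrow> real \<Rightarrow> hfun \<Rightarrow> bool" where
  "eigenvector j k V \<longleftrightarrow> V \<in> D0 \<and> (\<forall>g. alpha0 g V = scale0 (ee (k * g $ j)) V)"

text \<open>The action commutes with the involution, and conjugating the phase changes the sign of
  \<open>k\<close>.\<close>

lemma eigenvector_star0:
  assumes "eigenvector j k V"
  shows "eigenvector j (- k) (star0 V)"
proof -
  have "star0 (scale0 z V) = scale0 (cnj z) (star0 V)" for z
    by (simp add: star0_def scale0_def fun_eq_iff)
  then show ?thesis using assms by (simp add: eigenvector_def star0_D0 alpha0_star0)
qed

lemma smoothD_eigenvector:
  assumes "eigenvector j k V"
  shows "emb V \<in> smoothD"
  using assms C_k_character[of V _ 1 k j]
  by (simp add: eigenvector_def smoothD_def emb_D alpha_emb)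

lemma alpha0_unit0: "alpha0 g unit0 = unit0"
  by (simp add: alpha0_eq unit0_def fun_eq_iff)

text \<open>The unit is fixed by the action and contributes nothing, so subtracting it leaves the
  derivative of \<open>V\<close> alone.\<close>

lemma deriv_D_eigenvector:
  assumes V: "eigenvector j k V"
  shows "deriv_D i (emb (diff0 V unit0)) =
    emb (scale0 (if i = j then 2 * of_real pi * \<i> * of_real k else 0) V)"
proof (rule deriv_D_emb)
  have D0: "V \<in> D0" using V by (simp add: eigenvector_def)
  then show "diff0 V unit0 \<in> D0" by (simp add: diff0_D0 unit0_D0)
  have "alpha g (emb (diff0 V unit0)) =
      emb (add0 (scale0 (1 * ee (k * g $ j)) V) (scale0 (- 1) unit0))" for g
    using V D0 by (simp add: eigenvector_def alpha_emb diff0_D0 unit0_D0 alpha0_diff0 alpha0_unit0)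
      (simp add: diff0_eq_add0)
  then show "has_partialD i (\<lambda>g. alpha g (emb (diff0 V unit0)))
      (emb (scale0 (if i = j then 2 * of_real pi * \<i> * of_real k else 0) V)) 0"
    using has_partialD_character[OF D0 scale0_D0[OF unit0_D0], of i 1 k j "- 1" 0] by simp
  show "scale0 (if i = j then 2 * of_real pi * \<i> * of_real k else 0) V \<in> D0"
    by (rule scale0_D0[OF D0])
qed

subsection \<open>The pairings\<close>

text \<open>The only extensional index function is 0 up to \<open>n\<close>. Its default
  \<open>undefined\<close> beyond \<open>n\<close> never reaches a cochain of degree
  \<open>n\<close> that reads only the arguments 0 to \<open>n\<close>, as \<open>phi\<close> and
  \<open>phi123\<close> do in degrees 1 and 3.\<close>

lemma cup_Tr_1: "cup_Tr 1 n \<phi> A =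
    \<phi> (\<lambda>j. A j (if j \<le> n then 0 else undefined) 0)"
proof -
  have "({..n} \<rightarrow>\<^sub>E {..<1::nat}) = {\<lambda>j. if j \<le> n then 0 else undefined}"
    by (auto simp: PiE_iff extensional_def fun_eq_iff split: if_splits)
  moreover have "Suc j mod Suc n \<le> n" for j
    using mod_less_divisor[of "Suc n" "Suc j"] by linarith
  ultimately show ?thesis by (simp add: cup_Tr_def)
qed

lemma unitaryD_eigenvector:
  assumes V: "eigenvector j k V" "mult0 (star0 V) V = unit0" "mult0 V (star0 V) = unit0"
  shows "unitaryD (emb V)"
  using smoothD_eigenvector[OF V(1)] V
  by (simp add: unitaryD_def eigenvector_def starD_emb multD_emb star0_D0)

lemma pairing_phi_eigenvector:
  assumes V: "eigenvector j k V" "mult0 (star0 V) V = unit0"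
  shows "pairing1 1 (emb V) (phi i) = (1 / 2) / csqrt (2 * \<i>) * inverse (Gamma (3 / 2)) *
    ((if i = j then 2 * of_real pi * \<i> * of_real k else 0) * (1 - tau0 V))"
proof -
  define w where "w = (if i = j then 2 * of_real pi * \<i> * of_real k else 0)"
  have D0: "V \<in> D0" using V by (simp add: eigenvector_def)
  have mult_scale: "mult0 F (scale0 z G) = scale0 z (mult0 F G)" for F z G
    by (simp add: mult0_def scale0_def fun_eq_iff sum_distrib_left mult_ac)
  have unit_V: "mult0 unit0 V = V" by (simp add: unit0_eq_lift0 mult0_lift0_left)
  have "tau0 unit0 = 1" by (simp add: tau0_def unit0_def)
  \<comment> \<open>With w the eigenvalue of the derivation, (V* - 1) w V = w (1 - V) because V*V =
    1.\<close>
  then have "tau0 (mult0 (diff0 (star0 V) unit0) (scale0 w V)) = w * (1 - tau0 V)"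
    by (simp add: mult_scale mult0_diff0_left D0 star0_D0 unit0_D0 V(2) unit_V tau0_scale0 tau0_diff0)
  then have "tau (multD (diffD (starD (emb V)) (emb unit0))
      (deriv_D i (diffD (emb V) (emb unit0)))) = w * (1 - tau0 V)"
    using D0 deriv_D_eigenvector[OF V(1), of i, folded w_def]
    by (simp add: starD_emb diffD_emb star0_D0 unit0_D0 multD_emb scale0_D0 diff0_D0 tau_emb mult0_D0)
  then show ?thesis
    by (simp add: pairing1_def pairing_def cup_Tr_1[simplified] phi_def mat_diff_def mat_star_def
        mat_one_def w_def)
qed

text \<open>Each term applies three distinct derivations to V - 1 or V* - 1, and all but the one in
  direction \<open>j\<close> vanish there.\<close>

lemma pairing_phi123_eigenvector:
  assumes V: "eigenvector j k V"
  shows "pairing1 3 (emb V) phi123 = 0"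
proof -
  let ?a = "\<lambda>m::nat. if even m then diffD (starD (emb V)) (emb unit0) else diffD (emb V) (emb unit0)"
  have D0: "V \<in> D0" using V by (simp add: eigenvector_def)
  have a: "?a 0 = emb (diff0 (star0 V) unit0)"
    using D0 by (simp add: starD_emb diffD_emb star0_D0 unit0_D0)
  have deriv: "\<exists>W\<in>D0. deriv_D i (?a m) = emb W \<and> (i \<noteq> j \<longrightarrow> W = zero0)" for i m
  proof -
    have zero: "scale0 0 F = zero0" for F by (simp add: scale0_def zero0_def)
    have "deriv_D i (?a m) = (if even m
        then emb (scale0 (if i = j then 2 * of_real pi * \<i> * of_real (- k) else 0) (star0 V))
        else emb (scale0 (if i = j then 2 * of_real pi * \<i> * of_real k else 0) V))"
      using D0 deriv_D_eigenvector[OF V, of i] deriv_D_eigenvector[OF eigenvector_star0[OF V], of i]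
      by (simp add: starD_emb diffD_emb star0_D0 unit0_D0)
    then show ?thesis
      using D0 by (cases "even m") (auto simp: scale0_D0 star0_D0 zero zero0_D0)
  qed
  have mult_zero: "mult0 zero0 F = zero0" "mult0 F zero0 = zero0" for F
    by (simp_all add: mult0_def zero0_def supp_def fun_eq_iff)
  have tau_zero: "tau0 zero0 = 0" by (simp add: tau0_def zero0_def)
  have "tau (multD (multD (multD (?a 0) (deriv_D (\<sigma> 1) (?a 1))) (deriv_D (\<sigma> 2) (?a 2)))
      (deriv_D (\<sigma> 3) (?a 3))) = 0" if \<sigma>: "\<sigma> permutes (UNIV :: 3 set)" for \<sigma> :: "3 \<Rightarrow> 3"
  proof -
    obtain W1 W2 W3 where W: "W1 \<in> D0" "W2 \<in> D0" "W3 \<in> D0"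
      "deriv_D (\<sigma> 1) (?a 1) = emb W1" "deriv_D (\<sigma> 2) (?a 2) = emb W2"
      "deriv_D (\<sigma> 3) (?a 3) = emb W3"
      "\<sigma> 1 \<noteq> j \<longrightarrow> W1 = zero0" "\<sigma> 2 \<noteq> j \<longrightarrow> W2 = zero0"
      using deriv[of "\<sigma> 1" 1] deriv[of "\<sigma> 2" 2] deriv[of "\<sigma> 3" 3] by blast
    \<comment> \<open>Two distinct directions cannot both be \<open>j\<close>, so the first two
      derivations already produce a zero factor.\<close>
    have "\<sigma> 1 \<noteq> \<sigma> 2" using permutes_inj[OF \<sigma>] by (simp add: inj_eq)
    then have "W1 = zero0 \<or> W2 = zero0" using W by auto
    then have "mult0 (mult0 (mult0 (diff0 (star0 V) unit0) W1) W2) W3 = zero0"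
      by (auto simp: mult_zero)
    then show ?thesis
      unfolding W(4-6) a using W(1-3) D0
      by (simp add: multD_emb mult0_D0 diff0_D0 star0_D0 unit0_D0 zero0_D0 tau_emb tau_zero)
  qed
  then have "phi123 ?a = 0" by (simp add: phi123_def)
  then show ?thesis
    by (simp add: pairing1_def pairing_def cup_Tr_1[simplified] phi123_def mat_diff_def mat_star_def
        mat_one_def)
qed

text \<open>The sign of \<open>k\<close> comes from the action translating \<open>x\<close> to
  \<open>x - r\<close>; the phase of the action is trivial in degree 0.\<close>

lemma eigenvector_U1: "eigenvector 1 (- 1) U1"
  unfolding eigenvector_def
proof (intro conjI allI U1_D0)
  show "alpha0 g U1 = scale0 (ee (- 1 * g $ 1)) U1" for g
    by (simp add: alpha0_eq scale0_def U1_def fun_eq_iff flip: ee_add)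
qed

lemma eigenvector_U2: "eigenvector 2 (- 1) U2"
  unfolding eigenvector_def
proof (intro conjI allI U2_D0)
  show "alpha0 g U2 = scale0 (ee (- 1 * g $ 2)) U2" for g
    by (simp add: alpha0_eq scale0_def U2_def fun_eq_iff flip: ee_add)
qed

lemma star0_mult0_U1: "mult0 (star0 U1) U1 = unit0" "mult0 U1 (star0 U1) = unit0"
  by (simp_all add: U1_eq_lift0 star0_lift0 mult0_lift0 unit0_eq_lift0)

lemma star0_mult0_U2: "mult0 (star0 U2) U2 = unit0" "mult0 U2 (star0 U2) = unit0"
  by (simp_all add: U2_eq_lift0 star0_lift0 mult0_lift0 unit0_eq_lift0)

end

section \<open>Evaluation of the trace and of the normalising constant\<close>

lemma integral_ee: "integral {0..1} ee = 0"
proof -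
  have "(ee has_integral ee 1 / (2 * of_real pi * \<i>) - ee 0 / (2 * of_real pi * \<i>)) {0..1}"
  proof (rule fundamental_theorem_of_calculus)
    fix x :: real
    show "((\<lambda>x. ee x / (2 * of_real pi * \<i>)) has_vector_derivative ee x) (at x within {0..1})"
      unfolding ee_def
      by (rule has_vector_derivative_real_field)
        (auto intro!: derivative_eq_intros simp: field_simps)
  qed simp
  then show ?thesis using ee_of_int[of 1] by (simp add: integral_unique)
qed

lemma tau0_U1: "tau0 U1 = 0"
  by (simp add: tau0_def U1_def integral_ee)

lemma tau0_U2: "tau0 U2 = 0"
  by (simp add: tau0_def U2_def integral_ee)

text \<open>Gamma(3/2) is half the square root of pi, so the left side is -2 pi i divided by
  \<open>csqrt (2 * \<i>)\<close> and \<open>sqrt pi\<close>, that is, minus the product of these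
  two roots.\<close>

lemma pairing_constant:
  "(1 / 2) / csqrt (2 * \<i>) * inverse (Gamma (3 / 2)) * (2 * of_real pi * \<i> * of_real (- 1)) =
    - csqrt (\<i> * 2 * of_real pi)"
proof -
  have Gamma: "Gamma (3 / 2 :: complex) = of_real (sqrt pi) / 2"
    using Gamma_plus1[of "1 / 2 :: complex"] Gamma_one_half_complex
      not_in_Ints_imp_not_in_nonpos_Ints[OF fraction_not_in_Ints[where 'a = complex, of 2 1]]
    by simp
  \<comment> \<open>Principal roots are not multiplicative in general; here the positive factor
    \<open>sqrt pi\<close> keeps the product in the right half plane.\<close>
  have csqrt: "csqrt (\<i> * 2 * of_real pi) = csqrt (2 * \<i>) * of_real (sqrt pi)"
  proof (rule csqrt_unique)
    show "(csqrt (2 * \<i>) * of_real (sqrt pi))\<^sup>2 = \<i> * 2 * of_real pi"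
      by (simp add: power_mult_distrib flip: of_real_power)
    show "0 < Re (csqrt (2 * \<i>) * of_real (sqrt pi)) \<or>
        Re (csqrt (2 * \<i>) * of_real (sqrt pi)) = 0 \<and> 0 \<le> Im (csqrt (2 * \<i>) * of_real (sqrt pi))"
      by (simp add: norm_mult)
  qed
  have sq: "csqrt (2 * \<i>) * csqrt (2 * \<i>) = 2 * \<i>" "complex_of_real (sqrt pi) * of_real (sqrt pi) = of_real pi"
    using power2_csqrt[of "2 * \<i>"] by (simp_all add: power2_eq_square flip: of_real_mult)
  have nz: "csqrt (2 * \<i>) \<noteq> 0" "complex_of_real (sqrt pi) \<noteq> 0" by simp_all
  \<comment> \<open>Writing the numerator as a product of squares lets one copy of each root cancel
    against the denominator.\<close>
  have "2 * \<i> * complex_of_real pi =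
      (csqrt (2 * \<i>) * csqrt (2 * \<i>)) * (complex_of_real (sqrt pi) * of_real (sqrt pi))"
    by (simp only: sq)
  then show ?thesis
    unfolding Gamma csqrt using nz by (simp add: field_simps)
qed

theorem proposition5p6:
  fixes c :: int and mu nu :: real
  assumes "c \<ge> 1"
  defines "u1 \<equiv> quantum_heisenberg.emb c mu nu U1"
    and "u2 \<equiv> quantum_heisenberg.emb c mu nu U2"
    and "phi \<equiv> quantum_heisenberg.phi c mu nu"
    and "phi123 \<equiv> quantum_heisenberg.phi123 c mu nu"
    and "pairing \<equiv> quantum_heisenberg.pairing1 c mu nu"
  shows "quantum_heisenberg.unitaryD c mu nu u1 \<and>
     quantum_heisenberg.unitaryD c mu nu u2 \<and>
     pairing 1 u1 (phi 1) = - csqrt (\<i> * 2 * of_real pi) \<and>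
     pairing 1 u1 (phi 2) = 0 \<and>
     pairing 1 u1 (phi 3) = 0 \<and>
     pairing 3 u1 phi123 = 0 \<and>
     pairing 1 u2 (phi 1) = 0 \<and>
     pairing 1 u2 (phi 2) = - csqrt (\<i> * 2 * of_real pi) \<and>
     pairing 1 u2 (phi 3) = 0 \<and>
     pairing 3 u2 phi123 = 0"
proof -
  interpret H: quantum_heisenberg c mu nu .
  \<comment> \<open>The trace of \<open>U1\<close> vanishes, so 1 - \<open>tau0 U1\<close> is 1 and
    only the scalar of the derivation remains, which is 0 unless \<open>i = 1\<close>.\<close>
  have U1: "H.pairing1 1 u1 (H.phi i) = (if i = 1 then - csqrt (\<i> * 2 * of_real pi) else 0)" for i
    unfolding u1_def H.pairing_phi_eigenvector[OF H.eigenvector_U1 H.star0_mult0_U1(1)] tau0_U1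
    by (simp flip: pairing_constant)
  have U2: "H.pairing1 1 u2 (H.phi i) = (if i = 2 then - csqrt (\<i> * 2 * of_real pi) else 0)" for i
    unfolding u2_def H.pairing_phi_eigenvector[OF H.eigenvector_U2 H.star0_mult0_U2(1)] tau0_U2
    by (simp flip: pairing_constant)
  have "H.pairing1 3 u1 H.phi123 = 0" "H.pairing1 3 u2 H.phi123 = 0"
    unfolding u1_def u2_def
    by (rule H.pairing_phi123_eigenvector[OF H.eigenvector_U1] H.pairing_phi123_eigenvector[OF H.eigenvector_U2])+
  moreover have "H.unitaryD u1" "H.unitaryD u2"
    unfolding u1_def u2_def
    by (rule H.unitaryD_eigenvector[OF H.eigenvector_U1 H.star0_mult0_U1]
        H.unitaryD_eigenvector[OF H.eigenvector_U2 H.star0_mult0_U2])+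
  ultimately show ?thesis
    unfolding pairing_def phi_def phi123_def U1 U2 by simp
qed

end
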